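(* Let $k\geq 0$, let $t_1,\dots,t_k$ be (not necessarily distinct) integers with each $t_i\geq 4$, and let $$m=4+\sum_{i=1}^{k}(t_i-4).$$ Then the algorithm $\mathcal{A}$ described in the context, with input $T=(t_1,\dots,t_k)$, constructs a self-dual polyhedral graph $G(T)$ of degree sequence $$t_1,t_2,\dots,t_k,3^m .$$ Inputting a permutation of the $t_i$ in $\mathcal{A}$ produces, in general, non-isomorphic graphs; that is, there exist a tuple $T$ and a permutation $T'$ of $T$ such that $G(T)\not\cong G(T')$. The running time (number of elementary operations) of $\mathcal{A}$ is linear in the order of $G(T)$.
   Context: All graphs are finite and simple. A polyhedral graph (or polyhedron) is a planar, $3$-connected graph; it has an essentially unique embedding in the sphere, so its faces are well defined. Its dual is again polyhedral; a polyhedral graph is self-dual if it is isomorphic to its dual. The degree sequence is the multiset of vertex degrees, and $3^m$ means that $3$ is repeated $m$ times. The order of a graph is its number of vertices. Radial graph: for a plane graph $G$, the radial graph $R_G$ has as vertices the vertices and the faces (regions) of $G$, with an edge $uv$ whenever $u$ is a vertex of $G$ lying on the boundary of the face $v$ of $G$. It is bipartite, and if $G$ is polyhedral then $R_G$ is a $3$-connected quadrangulation of the sphere (every face is a $4$-cycle). One recovers $G$ from $R_G$ by taking the part of the bipartition corresponding to vertices of $G$ and joining two such vertices by an edge whenever they lie on a common face of $R_G$; the other part gives the dual $G^*$ in the same way. Lower-case letters below denote vertices of $R_G$ that are vertices of $G$, upper-case letters those that are vertices of $G^*$. Configuration $H$: six distinct vertices $a,b,c,A,B,C$ of $R$ such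 that $c\,B\,a\,C$ and $c\,A\,b\,C$ are two faces of $R$ sharing the edge $cC$ (so the edges are $aB,aC,bA,bC,cA,cB,cC$). Transformation $\mathcal{P}$ applied to $H$: delete the edge $cC$, and add, inside the resulting hexagonal region bounded by $a,B,c,A,b,C$, two new vertices $d$ and $D$ and the new edges $aD,cD,dD,dA,dC$. (On $G$ this has the effect of replacing the edge $bc$ by a path $b\,d\,c$ and adding the edge $ad$; on $G^*$, of replacing the edge $BC$ by a path $B\,D\,C$ and adding the edge $AD$.) Algorithm $\mathcal{A}$: the input is a $k$-tuple $T=(t_1,\dots,t_k)$ of integers $t_i\ge 4$. Start with $R$ equal to the cube graph (the radial graph of the tetrahedron) and a configuration $H$ in it, that is, six distinct vertices of the cube labelled $a,b,c,A,B,C$ such that $c\,B\,a\,C$ and $c\,A\,b\,C$ are two faces of the cube sharing the edge $cC$, with $a,b,c$ in the part of the bipartition corresponding to vertices of the tetrahedron and $A,B,C$ in the other part. For $i=1,\dots,k$ in order, apply $\mathcal{P}$ to the current labelled configuration $t_i-3$ times in succession. Between two consecutive applications belonging to the same index $i$, relabel the configuration so that the new $(a,b,c,A,B,C)$ is the old $(a,c,d,A,C,D)$. After the last of the $t_i-3$ applications, instead relabel so that the new $(a,b,c,A,B,C)$ is the old $(c,a,d,C,A,D)$. When all $t_i$ have been processed, $R=R_{G(T)}$, and the output is the graph $G(T)$ whose vertices are those in the lower-case part of the bipartition of $R$, two such vertices being joined by an edge whenever they lie on a common face of $R$. *)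

theory Defs
  imports
    Complex_Main
    "HOL-Library.Multiset"
    "HOL-Combinatorics.Orbits"
    "Graph_Theory.Graph_Theory"
begin

section \<open>Polyhedral graphs, duals, self-duality\<close>

text \<open>
  A finite simple undirected graph is a \<^const>\<open>pair_graph\<close>: every edge is a pair of opposite arcs.
\<close>

definition k_vertex_connected :: "nat \<Rightarrow> 'a pair_pre_digraph \<Rightarrow> bool" where
  "k_vertex_connected k G \<longleftrightarrow>
     card (pverts G) > k \<and>
     (\<forall>S. S \<subseteq> pverts G \<and> card S < k \<longrightarrow> connected (with_proj G \<restriction> (pverts G - S)))"

text \<open>
  Embeddings in oriented surfaces are given, up to homeomorphism, by combinatorial maps: \<open>\<sigma>\<close> sends an
  arc leaving a vertex to the next arc leaving that vertex in the rotation around it.  The face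
  boundaries are the orbits of ``reverse the arc, then turn to the next one''.
\<close>

definition rotation_system :: "'a pair_pre_digraph \<Rightarrow> ('a \<times> 'a \<Rightarrow> 'a \<times> 'a) \<Rightarrow> bool" where
  "rotation_system G \<sigma> \<longleftrightarrow>
     \<sigma> permutes parcs G \<and>
     (\<forall>v\<in>pverts G. out_arcs (with_proj G) v \<noteq> {} \<longrightarrow> cyclic_on \<sigma> (out_arcs (with_proj G) v))"

definition face_of :: "('a \<times> 'a \<Rightarrow> 'a \<times> 'a) \<Rightarrow> 'a \<times> 'a \<Rightarrow> ('a \<times> 'a) set" where
  "face_of \<sigma> e = orbit (\<sigma> \<circ> prod.swap) e"

definition map_faces :: "'a pair_pre_digraph \<Rightarrow> ('a \<times> 'a \<Rightarrow> 'a \<times> 'a) \<Rightarrow> ('a \<times> 'a) set set" where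
  "map_faces G \<sigma> = face_of \<sigma> ` parcs G"

text \<open>
  For a connected graph with at least one edge, the surface of the map is the sphere iff
  \<open>V - E + F = 2\<close>, where \<open>E\<close> is half the number of arcs.  Below it is only used for 3-connected graphs.
\<close>

definition sphere_embedding :: "'a pair_pre_digraph \<Rightarrow> ('a \<times> 'a \<Rightarrow> 'a \<times> 'a) \<Rightarrow> bool" where
  "sphere_embedding G \<sigma> \<longleftrightarrow>
     connected (with_proj G) \<and> rotation_system G \<sigma> \<and>
     card (pverts G) + card (map_faces G \<sigma>) = card (parcs G) div 2 + 2"

definition polyhedral :: "'a pair_pre_digraph \<Rightarrow> bool" where
  "polyhedral G \<longleftrightarrow> pair_graph G \<and> k_vertex_connected 3 G \<and> (\<exists>\<sigma>. sphere_embedding G \<sigma>)"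

text \<open>
  Every edge joins the two faces on its sides.  Two faces of a polyhedral graph share at most one
  edge and no edge has the same face on both sides, so the dual is again simple.
\<close>

definition dual_graph ::
  "'a pair_pre_digraph \<Rightarrow> ('a \<times> 'a \<Rightarrow> 'a \<times> 'a) \<Rightarrow> ('a \<times> 'a) set pair_pre_digraph" where
  "dual_graph G \<sigma> =
     \<lparr> pverts = map_faces G \<sigma>, parcs = (\<lambda>e. (face_of \<sigma> e, face_of \<sigma> (prod.swap e))) ` parcs G \<rparr>"

text \<open>
  By Whitney's theorem the sphere embedding of a polyhedral graph is unique up to reflection, so its
  dual does not depend on the choice of \<open>\<sigma>\<close>.
\<close>

definition self_dual :: "'a pair_pre_digraph \<Rightarrow> bool" where
  "self_dual G \<longleftrightarrow>
     (\<exists>\<sigma>. sphere_embedding G \<sigma> \<and> digraph_iso (with_proj G) (with_proj (dual_graph G \<sigma>)))"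

definition order :: "'a pair_pre_digraph \<Rightarrow> nat" where
  "order G = card (pverts G)"

definition degree_sequence :: "'a pair_pre_digraph \<Rightarrow> nat multiset" where
  "degree_sequence G = image_mset (out_degree (with_proj G)) (mset_set (pverts G))"


section \<open>The algorithm\<close>

text \<open>
  The vertices of \<open>R\<close>: \<open>Lo\<close> is the lower-case part of the bipartition, \<open>Up\<close> the upper-case part.
\<close>

datatype rvertex = Lo nat | Up nat

text \<open>The labels \<open>a, b, c, d\<close> and \<open>A, B, C, D\<close>.\<close>

datatype label = La | Lb | Lc | Ld | UA | UB | UC | UD

text \<open>
  The lower-case vertices of \<open>R\<close> are \<open>Lo 0, \<dots>, Lo (nlow - 1)\<close>, and similarly for the upper-case ones.
  A face is recorded by its vertex set: as \<open>R\<close> is a bipartite quadrangulation, this set consists of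
  two lower-case and two upper-case vertices, which alternate along the boundary.
  The field \<open>outp\<close> is the output graph.
\<close>

record state =
  nlow :: nat
  nup :: nat
  redges :: "rvertex set set"
  rfaces :: "rvertex set list"
  lab :: "label \<Rightarrow> rvertex"
  outp :: "rvertex pair_pre_digraph"

text \<open>
  The elementary operations.  Each of them inserts or deletes a single vertex, edge or face of \<open>R\<close>,
  copies one label, performs one step of loop control (read the next \<open>t\<^sub>i\<close>, or update and test a counter),
  or outputs one vertex of \<open>G\<close> or the edge of \<open>G\<close> coming from one face of \<open>R\<close>.  If the edges and faces are
  kept in doubly linked lists, each takes constant time: what is deleted is always adjacent to the
  labelled configuration, so that pointers to it are at hand.
\<close>

datatype elem_op =
    New_Low label
  | New_Up label
  | Insert_Edge label label
  | Delete_Edge label label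
  | Insert_Face label label label label
  | Delete_Face label label label label
  | Assign label label
  | Loop_Control
  | Out_Vertex rvertex
  | Out_Face "rvertex set"

primrec exec :: "elem_op \<Rightarrow> state \<Rightarrow> state" where
  "exec (New_Low l) s = s\<lparr> nlow := Suc (nlow s), lab := (lab s)(l := Lo (nlow s)) \<rparr>"
| "exec (New_Up l) s = s\<lparr> nup := Suc (nup s), lab := (lab s)(l := Up (nup s)) \<rparr>"
| "exec (Insert_Edge k l) s = s\<lparr> redges := insert {lab s k, lab s l} (redges s) \<rparr>"
| "exec (Delete_Edge k l) s = s\<lparr> redges := redges s - {{lab s k, lab s l}} \<rparr>"
| "exec (Insert_Face k l m n) s =
     s\<lparr> rfaces := {lab s k, lab s l, lab s m, lab s n} # rfaces s \<rparr>"
| "exec (Delete_Face k l m n) s =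
     s\<lparr> rfaces := remove1 {lab s k, lab s l, lab s m, lab s n} (rfaces s) \<rparr>"
| "exec (Assign k l) s = s\<lparr> lab := (lab s)(k := lab s l) \<rparr>"
| "exec Loop_Control s = s"
| "exec (Out_Vertex v) s = s\<lparr> outp := (outp s)\<lparr> pverts := insert v (pverts (outp s)) \<rparr> \<rparr>"
| "exec (Out_Face F) s = s\<lparr> outp := (outp s)\<lparr> parcs := parcs (outp s) \<union>
     {(u, w). u \<in> F \<inter> range Lo \<and> w \<in> F \<inter> range Lo \<and> u \<noteq> w} \<rparr> \<rparr>"

text \<open>
  Deleting \<open>cC\<close> merges its two faces into the hexagon \<open>a, B, c, A, b, C\<close>, which the new edges cut into
  the four new faces.
\<close>

definition transform_P :: "elem_op list" where
  "transform_P =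
     [Delete_Edge Lc UC, New_Low Ld, New_Up UD,
      Insert_Edge La UD, Insert_Edge Lc UD, Insert_Edge Ld UD, Insert_Edge Ld UA, Insert_Edge Ld UC,
      Delete_Face Lc UB La UC, Delete_Face Lc UA Lb UC,
      Insert_Face La UB Lc UD, Insert_Face Lc UA Ld UD,
      Insert_Face Ld UA Lb UC, Insert_Face La UC Ld UD]"

text \<open>
  New \<open>(a,b,c,A,B,C)\<close> is old \<open>(a,c,d,A,C,D)\<close>; the assignments are executed in order, and each label is
  read before it is overwritten.
\<close>

definition relabel_between :: "elem_op list" where
  "relabel_between = [Assign Lb Lc, Assign Lc Ld, Assign UB UC, Assign UC UD]"

text \<open>New \<open>(a,b,c,A,B,C)\<close> is old \<open>(c,a,d,C,A,D)\<close>.\<close>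

definition relabel_last :: "elem_op list" where
  "relabel_last =
     [Assign Lb La, Assign La Lc, Assign Lc Ld, Assign UB UA, Assign UA UC, Assign UC UD]"

definition process_entry :: "nat \<Rightarrow> elem_op list" where
  "process_entry t =
     Loop_Control #
     concat (map (\<lambda>j. Loop_Control # transform_P @ (if j < t - 3 then relabel_between else relabel_last))
       [1..<Suc (t - 3)])"

definition process_tuple :: "nat list \<Rightarrow> elem_op list" where
  "process_tuple T = concat (map process_entry T)"

definition output_graph :: "state \<Rightarrow> elem_op list" where
  "output_graph s = map (\<lambda>i. Out_Vertex (Lo i)) [0..<nlow s] @ map Out_Face (rfaces s)"

text \<open>Execution, counting the elementary operations.\<close>

definition run :: "elem_op list \<Rightarrow> state \<times> nat \<Rightarrow> state \<times> nat" where
  "run ops = (\<lambda>(s, n). (fold exec ops s, n + length ops))"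

definition algorithm_A :: "state \<Rightarrow> nat list \<Rightarrow> state \<times> nat" where
  "algorithm_A s T =
     (let (s', n) = run (process_tuple T) (s, 0) in run (output_graph s') (s', n))"

definition result_graph :: "state \<Rightarrow> nat list \<Rightarrow> rvertex pair_pre_digraph" where
  "result_graph s T = outp (fst (algorithm_A s T))"

definition running_time :: "state \<Rightarrow> nat list \<Rightarrow> nat" where
  "running_time s T = snd (algorithm_A s T)"

definition configuration :: "state \<Rightarrow> bool" where
  "configuration s \<longleftrightarrow>
     (let a = lab s La; b = lab s Lb; c = lab s Lc; A = lab s UA; B = lab s UB; C = lab s UC in
        distinct [a, b, c, A, B, C] \<and> {a, b, c} \<subseteq> range Lo \<and> {A, B, C} \<subseteq> range Up \<and>
        {{a, B}, {a, C}, {b, A}, {b, C}, {c, A}, {c, B}, {c, C}} \<subseteq> redges s \<and>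
        {{c, B, a, C}, {c, A, b, C}} \<subseteq> set (rfaces s))"

text \<open>
  The cube as radial graph of the tetrahedron with vertices \<open>0, 1, 2, 3\<close>: \<open>Up j\<close> is the face opposite to
  the vertex \<open>j\<close>, so it is adjacent to all \<open>Lo i\<close> with \<open>i \<noteq> j\<close>, and the edge \<open>ik\<close> of the tetrahedron
  gives the face with vertices \<open>Lo i, Lo k, Up j, Up l\<close>, where \<open>{i, j, k, l} = {0, 1, 2, 3}\<close>.
  The labels \<open>d\<close> and \<open>D\<close> are initially irrelevant.
\<close>

definition cube_start :: "state \<Rightarrow> bool" where
  "cube_start s \<longleftrightarrow>
     nlow s = 4 \<and> nup s = 4 \<and>
     redges s = {{Lo i, Up j} |i j. i < 4 \<and> j < 4 \<and> i \<noteq> j} \<and>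
     rfaces s =
       [{Lo 0, Lo 1, Up 2, Up 3}, {Lo 0, Lo 2, Up 1, Up 3}, {Lo 0, Lo 3, Up 1, Up 2},
        {Lo 1, Lo 2, Up 0, Up 3}, {Lo 1, Lo 3, Up 0, Up 2}, {Lo 2, Lo 3, Up 0, Up 1}] \<and>
     outp s = \<lparr> pverts = {}, parcs = {} \<rparr> \<and>
     configuration s"

definition valid_input :: "nat list \<Rightarrow> bool" where
  "valid_input T \<longleftrightarrow> (\<forall>t\<in>set T. 4 \<le> t)"

end

theory Submission
  imports Defs
begin

text \<open>
  The proof follows \<open>G\<close> and its dual through the algorithm and reads \<open>R\<close> off from them.  A plane map is
  given by its arcs \<open>E\<close>, the rotation \<open>\<sigma>\<close>, and a function \<open>lf\<close> that names the face whose boundary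
  walk uses an arc.  The dual has the arcs \<open>(lf (u, w), lf (w, u))\<close>, and the face of \<open>R\<close> belonging to an
  edge \<open>uw\<close> is \<open>{u, w, lf (u, w), lf (w, u)}\<close>.

  \<^bold>\<open>Self-duality.\<close>  The configuration \<open>H\<close> is symmetric under the exchange of lower-case and upper-case
  letters, and so is \<open>P\<close>: on \<open>G\<close> it replaces \<open>bc\<close> by the path \<open>b d c\<close> and adds \<open>ad\<close>, on the dual it
  replaces \<open>BC\<close> by \<open>B D C\<close> and adds \<open>AD\<close>.  Hence an isomorphism \<open>\<psi>\<close> from \<open>G\<close> to its dual with
  \<open>\<psi> a = A\<close>, \<open>\<psi> b = B\<close>, \<open>\<psi> c = C\<close> extends by \<open>d \<mapsto> D\<close> (\<open>dual'\<close>).  The new labels satisfy the same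
  condition: directly after the last application of an entry (\<open>last_config\<close>), and up to reflecting the
  sphere between two applications (\<open>between_config\<close>).  The tetrahedron is the start (\<open>tetrahedron\<close>).

  \<^bold>\<open>Polyhedrality.\<close>  A step adds one vertex, one face and two edges, and \<open>boundary'\<close> follows the boundary
  walks through it, so the surface stays a sphere.  Subdividing an edge of a 3-connected graph and
  joining the new vertex to a third vertex leaves the graph 3-connected
  (\<open>three_connected_subdivide_join\<close>).

  \<^bold>\<open>Degrees.\<close>  A step raises the degree of \<open>a\<close> by one and adds a vertex of degree 3.  While an entry \<open>t\<close>
  is processed, \<open>a\<close> does not change, and \<open>a\<close> and \<open>c\<close> have degree 3 when it begins; so \<open>t - 3\<close> steps turn
  one 3 of the degree sequence into \<open>t\<close> and add \<open>t - 3\<close> new threes, a gain of \<open>t\<close> and of \<open>t - 4\<close> threes.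

  \<^bold>\<open>Order of the entries.\<close>  The inputs \<open>(4, 4, 5)\<close> and \<open>(4, 5, 4)\<close> give different graphs: in the second the
  vertex of degree 5 is adjacent to both vertices of degree 4, in the first only to one of them.

  \<^bold>\<open>Running time.\<close>  Each step costs a bounded number of operations and creates exactly one vertex, and a
  graph of order \<open>n\<close> is output from its \<open>n\<close> vertices and the \<open>2 n - 2\<close> faces of \<open>R\<close>.
\<close>

section \<open>Cyclic permutations\<close>

lemma cyclic_on_surj:
  assumes "cyclic_on f S"
  shows "f ` S = S"
proof -
  have "S \<subseteq> f ` S"
  proof
    fix x assume "x \<in> S"
    then have "x \<in> orbit f x" "orbit f x = S"
      using assms orbit_cyclic_eq3[OF assms] by (auto simp: cyclic_on_alldef)
    then show "x \<in> f ` S"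
      using \<open>x \<in> S\<close> by cases auto
  qed
  then show ?thesis using cyclic_on_inI[OF assms] by auto
qed

lemma cyclic_on_3:
  assumes "f x = y" "f y = z" "f z = x"
  shows "cyclic_on f {x, y, z}"
proof -
  have "orbit f x = {x, y, z}"
  proof
    show "orbit f x \<subseteq> {x, y, z}"
    proof
      fix u assume "u \<in> orbit f x"
      then show "u \<in> {x, y, z}" by induct (use assms in auto)
    qed
    have "y \<in> orbit f x" by (metis assms orbit.base)
    moreover from this have "z \<in> orbit f x" by (metis assms orbit.step)
    moreover from this have "x \<in> orbit f x" by (metis assms orbit.step)
    ultimately show "{x, y, z} \<subseteq> orbit f x" by simp
  qed
  then show ?thesis by (auto simp: cyclic_on_def)
qed

text \<open>
  Splices \<open>y\<close> into a cycle right after \<open>x\<close>; this is how a boundary walk or a rotation grows.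
\<close>

lemma cyclic_on_insert:
  assumes "cyclic_on f S" and "x \<in> S" "y \<notin> S"
    and gx: "g x = y" and gy: "g y = f x" and g: "\<And>z. z \<in> S \<Longrightarrow> z \<noteq> x \<Longrightarrow> g z = f z"
  shows "cyclic_on g (insert y S)"
proof -
  have S: "S = orbit f x" using assms(1,2) by (simp add: orbit_cyclic_eq3)
  have fx: "f x \<in> orbit g x" by (metis gx gy orbit.base orbit.step)
  have "u \<in> orbit g x" if "u \<in> orbit f x" for u
    using that
  proof induct
    case base then show ?case by (rule fx)
  next
    case (step u)
    then show ?case using fx g[of u] S orbit.step[of u g x] by (cases "u = x") auto
  qed
  moreover have "y \<in> orbit g x" by (metis gx orbit.base)
  moreover have "u \<in> insert y S" if "u \<in> orbit g x" for u
    using that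
  proof induct
    case base then show ?case by (simp add: gx)
  next
    case (step u)
    then show ?case using gx gy g[of u] cyclic_on_inI[OF assms(1)] \<open>x \<in> S\<close>
      by (cases "u = x") auto
  qed
  ultimately have "orbit g x = insert y S" using S by blast
  then show ?thesis using \<open>x \<in> S\<close> by (auto simp: cyclic_on_def)
qed

lemma cyclic_on_inverse:
  assumes "cyclic_on f S" "\<And>z. z \<in> S \<Longrightarrow> g (f z) = z"
  shows "cyclic_on g S"
proof -
  have returns: "s \<in> orbit g t" if "s \<in> S" "t \<in> S" for s t
  proof -
    have S: "orbit f s = S" using assms(1) that(1) by (rule orbit_cyclic_eq3)
    then have "t \<in> orbit f s" using that by simp
    then show ?thesis
    proof induct
      case base
      show ?case using assms(2)[OF that(1)] orbit.base[of g "f s"] by simp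
    next
      case (step t)
      then have "g (f t) = t" using assms(2) S by simp
      then have "t \<in> orbit g (f t)" using orbit.base[of g "f t"] by simp
      then show ?case using step(2) by (rule orbit_trans[rotated])
    qed
  qed
  obtain s where s: "s \<in> S" using assms(1) by (auto simp: cyclic_on_def)
  have gS: "g z \<in> S" if "z \<in> S" for z
    using that assms(2) cyclic_on_surj[OF assms(1)] by (metis imageE)
  have "u \<in> S" if "u \<in> orbit g s" for u
    using that by induct (use s gS in auto)
  then have "orbit g s = S" using returns s by blast
  then show ?thesis using s by (auto simp: cyclic_on_def)
qed

section \<open>Connectivity and cuts\<close>

text \<open>
  Connectedness of the subgraph induced on \<open>W\<close>, in the form that no proper nonempty part of \<open>W\<close> is closed
  under adjacency.  In this form a deleted edge only matters for the parts that it leaves.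
\<close>

definition cut_connected :: "'v rel \<Rightarrow> 'v set \<Rightarrow> bool" where
  "cut_connected E W \<longleftrightarrow>
     W \<noteq> {} \<and> (\<forall>X\<subseteq>W. X \<noteq> {} \<and> (\<forall>x\<in>X. \<forall>y\<in>W. (x, y) \<in> E \<longrightarrow> y \<in> X) \<longrightarrow> X = W)"

lemma cut_connectedI:
  assumes "W \<noteq> {}"
    and "\<And>X. X \<subseteq> W \<Longrightarrow> X \<noteq> {} \<Longrightarrow>
      (\<And>x y. x \<in> X \<Longrightarrow> y \<in> W \<Longrightarrow> (x, y) \<in> E \<Longrightarrow> y \<in> X) \<Longrightarrow> X = W"
  shows "cut_connected E W"
  using assms by (auto simp: cut_connected_def)

lemma cut_connectedD:
  assumes "cut_connected E W" "X \<subseteq> W" "X \<noteq> {}"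
    and "\<And>x y. x \<in> X \<Longrightarrow> y \<in> W \<Longrightarrow> (x, y) \<in> E \<Longrightarrow> y \<in> X"
  shows "X = W"
  using assms by (auto simp: cut_connected_def)

definition three_connected :: "'v set \<Rightarrow> 'v rel \<Rightarrow> bool" where
  "three_connected V E \<longleftrightarrow>
     3 < card V \<and> (\<forall>S\<subseteq>V. card S < 3 \<longrightarrow> cut_connected E (V - S))"

lemma connected_if_cut_connected:
  assumes "cut_connected E (verts H)"
    and "\<And>x y. (x, y) \<in> E \<Longrightarrow> x \<in> verts H \<Longrightarrow> y \<in> verts H \<Longrightarrow> (x, y) \<in> arcs_ends H"
  shows "connected H"
  unfolding connected_conv
proof (intro conjI ballI)
  show "verts H \<noteq> {}" using assms(1) by (simp add: cut_connected_def)
next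
  fix u v assume u: "u \<in> verts H" and v: "v \<in> verts H"
  let ?R = "rtrancl_on (verts H) (symcl (arcs_ends H))"
  let ?X = "{w. (u, w) \<in> ?R}"
  have "?X = verts H"
  proof -
    have "?X \<subseteq> verts H" by (auto dest: in_rtrancl_on_in_F)
    moreover have "u \<in> ?X" using u by simp
    moreover have "\<forall>x\<in>?X. \<forall>y\<in>verts H. (x, y) \<in> E \<longrightarrow> y \<in> ?X"
    proof (intro ballI impI)
      fix x y assume x: "x \<in> ?X" and y: "y \<in> verts H" and xy: "(x, y) \<in> E"
      have "x \<in> verts H" using x by (auto dest: in_rtrancl_on_in_F)
      then have "(x, y) \<in> symcl (arcs_ends H)" using assms(2)[OF xy] y by (auto simp: symcl_def)
      then show "y \<in> ?X" using x y by (auto intro: rtrancl_on_into_rtrancl_on)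
    qed
    ultimately show ?thesis by (intro cut_connectedD[OF assms(1)]) auto
  qed
  then show "(u, v) \<in> ?R" using v by auto
qed

lemma k_vertex_connected_3I:
  assumes "three_connected V E"
  shows "k_vertex_connected 3 \<lparr>pverts = V, parcs = E\<rparr>"
proof -
  have "connected (with_proj \<lparr>pverts = V, parcs = E\<rparr> \<restriction> (V - S))" if "S \<subseteq> V" "card S < 3" for S
    by (rule connected_if_cut_connected[where E = E])
      (use assms that in \<open>auto simp: three_connected_def arcs_ends_conv image_iff\<close>)
  then show ?thesis using assms by (simp add: k_vertex_connected_def three_connected_def)
qed

lemma three_connected_complete:
  assumes "3 < card V" "E = {(u, w). u \<in> V \<and> w \<in> V \<and> u \<noteq> w}"
  shows "three_connected V E"
proof -
  have fin: "finite V" using assms(1) by (simp add: card_ge_0_finite)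
  have "cut_connected E (V - S)" if "S \<subseteq> V" "card S < 3" for S
  proof -
    have "V - S \<noteq> {}" using that assms(1) by auto
    moreover have "(x, y) \<in> E" if "x \<in> V - S" "y \<in> V - S" "x \<noteq> y" for x y
      using that assms(2) by auto
    ultimately show ?thesis by (intro cut_connectedI) blast+
  qed
  then show ?thesis using assms(1) by (simp add: three_connected_def)
qed

text \<open>The effect of the transformation on the arcs of \<open>G\<close>, and, read in capitals, on those of its dual.\<close>

definition subdivide_join :: "'v rel \<Rightarrow> 'v \<Rightarrow> 'v \<Rightarrow> 'v \<Rightarrow> 'v \<Rightarrow> 'v rel" where
  "subdivide_join E a b c d =
     E - {(b, c), (c, b)} \<union> {(b, d), (d, b), (c, d), (d, c), (a, d), (d, a)}"

text \<open>
  Let \<open>S\<close> have at most two elements.  If \<open>d \<notin> S\<close>, then paths through \<open>bc\<close> are rerouted through \<open>d\<close>, and \<open>d\<close>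
  has a neighbour outside \<open>S\<close> because it has three neighbours.  If \<open>d \<in> S\<close>, then \<open>S\<close> removes at most
  one old vertex, and it remains to see that the edge \<open>bc\<close> can be removed in addition.
  A part of the rest that only \<open>bc\<close> leaves would have to be \<open>{b}\<close> by connectedness without \<open>b\<close>, and
  everything but \<open>c\<close> by connectedness without \<open>c\<close>, so that at most three vertices would exist in total.
\<close>

lemma three_connected_subdivide_join:
  assumes conn: "three_connected V E" and fin: "finite V"
    and abc: "a \<in> V" "b \<in> V" "c \<in> V" "a \<noteq> b" "a \<noteq> c" "b \<noteq> c" and d: "d \<notin> V"
  shows "three_connected (insert d V) (subdivide_join E a b c d)" (is "three_connected ?V ?E")
  unfolding three_connected_def
proof (intro conjI allI impI)
  have V: "3 < card V" and cut: "\<And>S. S \<subseteq> V \<Longrightarrow> card S < 3 \<Longrightarrow> cut_connected E (V - S)"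
    using conn by (auto simp: three_connected_def)
  show "3 < card ?V" using V fin d by simp
  fix S assume S: "S \<subseteq> ?V" "card S < 3"
  have finS: "finite S" using S(1) fin by (meson finite.insertI finite_subset)
  show "cut_connected ?E (?V - S)"
  proof (cases "d \<in> S")
    case False
    then have SV: "S \<subseteq> V" using S(1) by auto
    have W: "?V - S = insert d (V - S)" using False by auto
    have cW: "cut_connected E (V - S)" using cut SV S(2) .
    have "\<not> {a, b, c} \<subseteq> S"
    proof
      assume "{a, b, c} \<subseteq> S"
      then have "card {a, b, c} \<le> card S" using finS by (rule card_mono[rotated])
      then show False using S(2) abc by simp
    qed
    then obtain n where n: "n \<in> {a, b, c}" "n \<in> V - S" using abc by auto
    have dn: "(d, n) \<in> ?E" "(n, d) \<in> ?E" using n by (auto simp: subdivide_join_def)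
    have "X = insert d (V - S)"
      if X: "X \<subseteq> insert d (V - S)" "X \<noteq> {}"
        and closed: "\<And>x y. x \<in> X \<Longrightarrow> y \<in> insert d (V - S) \<Longrightarrow> (x, y) \<in> ?E \<Longrightarrow> y \<in> X" for X
    proof -
      have "n \<in> X" if "d \<in> X" using closed[OF that _ dn(1)] n by simp
      then have ne: "X - {d} \<noteq> {}" using X(2) n d by auto
      have step: "y \<in> X - {d}" if "x \<in> X - {d}" "y \<in> V - S" "(x, y) \<in> E" for x y
      proof (cases "(x, y) \<in> ?E")
        case True
        then show ?thesis using closed[of x y] that d by auto
      next
        case False
        then have "(x, y) = (b, c) \<or> (x, y) = (c, b)" using that by (auto simp: subdivide_join_def)
        then have "(x, d) \<in> ?E" "(d, y) \<in> ?E" by (auto simp: subdivide_join_def)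
        then show ?thesis using closed[of x d] closed[of d y] that d by auto
      qed
      have "X - {d} \<subseteq> V - S" using X(1) by auto
      then have "X - {d} = V - S" using ne step by (rule cut_connectedD[OF cW])
      moreover from this have "d \<in> X" using closed[OF _ _ dn(2)] n by auto
      ultimately show ?thesis by auto
    qed
    then show ?thesis unfolding W by (intro cut_connectedI) auto
  next
    case True
    define S0 where "S0 = S - {d}"
    have S0: "S0 \<subseteq> V" "card S0 < 2" "finite S0" using S True finS by (auto simp: S0_def)
    have W: "?V - S = V - S0" using True d by (auto simp: S0_def)
    have ins: "card (insert v S0) < 3" for v using S0 by (simp add: card_insert_if)
    have cW: "cut_connected E (V - S0)" by (rule cut) (use S0 in auto)
    have del: "cut_connected E (V - S0 - {v})" if "v \<in> V" for v
    proof -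
      have "cut_connected E (V - insert v S0)" by (rule cut) (use S0 ins that in auto)
      moreover have "V - insert v S0 = V - S0 - {v}" by auto
      ultimately show ?thesis by simp
    qed
    \<comment> \<open>no closed part is left by the edge \<open>bc\<close>; \<open>p\<close> is its end inside, \<open>q\<close> the one outside\<close>
    have sep: "\<not> (p \<in> X \<and> q \<notin> X)"
      if X: "X \<subseteq> V - S0" "X \<noteq> {}"
        and closed: "\<And>x y. x \<in> X \<Longrightarrow> y \<in> V - S0 \<Longrightarrow> (x, y) \<in> ?E \<Longrightarrow> y \<in> X"
        and pq: "{p, q} = {b, c}" "q \<in> V - S0" for X p q
    proof
      assume p: "p \<in> X \<and> q \<notin> X"
      have EE: "(x, y) \<in> ?E" if "(x, y) \<in> E" "x \<noteq> p \<or> y \<noteq> q" "x \<noteq> q" for x y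
        using that pq(1) unfolding subdivide_join_def by (auto simp: doubleton_eq_iff)
      have cp: "cut_connected E (V - S0 - {p})" and cq: "cut_connected E (V - S0 - {q})"
        using del abc pq(1) by (auto simp: doubleton_eq_iff)
      have "X - {p} = {}"
      proof (rule ccontr)
        assume ne: "X - {p} \<noteq> {}"
        have "X - {p} \<subseteq> V - S0 - {p}" using X(1) by auto
        then have "X - {p} = V - S0 - {p}" using ne
          by (rule cut_connectedD[OF cp]) (use closed EE p in auto)
        then show False using p pq abc by (auto simp: doubleton_eq_iff)
      qed
      then have Xp: "X = {p}" using p by auto
      have "X \<subseteq> V - S0 - {q}" using X(1) p by auto
      then have "X = V - S0 - {q}" using X(2)
        by (rule cut_connectedD[OF cq]) (use closed EE p in auto)
      then have "V \<subseteq> {p, q} \<union> S0" using Xp by auto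
      then have "card V \<le> card ({p, q} \<union> S0)" using S0 by (intro card_mono) auto
      also have "\<dots> \<le> card {p, q} + card S0" by (rule card_Un_le)
      also have "\<dots> \<le> 2 + 1" using S0 by (intro add_mono) (auto simp: card_insert_if)
      finally show False using V by simp
    qed
    have "X = V - S0"
      if X: "X \<subseteq> V - S0" "X \<noteq> {}"
        and closed: "\<And>x y. x \<in> X \<Longrightarrow> y \<in> V - S0 \<Longrightarrow> (x, y) \<in> ?E \<Longrightarrow> y \<in> X" for X
    proof -
      have "y \<in> X" if xy: "x \<in> X" "y \<in> V - S0" "(x, y) \<in> E" for x y
      proof (cases "(x, y) \<in> ?E")
        case True
        then show ?thesis using closed xy by blast
      next
        case False
        then have "{x, y} = {b, c}" using xy by (auto simp: subdivide_join_def)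
        then have "\<not> (x \<in> X \<and> y \<notin> X)" using closed xy(2) by (intro sep[OF X])
        then show ?thesis using xy by blast
      qed
      then show ?thesis by (rule cut_connectedD[OF cW X])
    qed
    then show ?thesis using cW unfolding W by (intro cut_connectedI) (auto simp: cut_connected_def)
  qed
qed

section \<open>Maps on the sphere and their duals\<close>

text \<open>
  The faces are abstract elements of \<open>U\<close>, and \<open>lf\<close> sorts the arcs by face, so that faces keep their names
  when the map is modified.  Vertices and faces play dual roles: \<open>\<sigma>\<close> is cyclic on each fibre of \<open>fst\<close>,
  and \<open>\<sigma> \<circ> prod.swap\<close> on each fibre of \<open>lf\<close>.
\<close>

locale plane_map =
  fixes V :: "'v set" and U :: "'f set" and E :: "'v rel"
    and \<sigma> :: "'v \<times> 'v \<Rightarrow> 'v \<times> 'v" and lf :: "'v \<times> 'v \<Rightarrow> 'f"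
  assumes finite_V: "finite V"
    and E_sub: "E \<subseteq> V \<times> V"
    and E_sym: "(u, w) \<in> E \<Longrightarrow> (w, u) \<in> E"
    and E_irrefl: "(u, u) \<notin> E"
    and fixed: "e \<notin> E \<Longrightarrow> \<sigma> e = e"
    and rotation: "v \<in> V \<Longrightarrow> cyclic_on \<sigma> {e \<in> E. fst e = v}"
    and boundary: "f \<in> U \<Longrightarrow> cyclic_on (\<sigma> \<circ> prod.swap) {e \<in> E. lf e = f}"
    and lf_in: "e \<in> E \<Longrightarrow> lf e \<in> U"
    and euler: "card V + card U = card E div 2 + 2"
begin

lemma finite_E: "finite E"
  using E_sub finite_V by (meson finite_SigmaI finite_subset)

lemma swap_E: "prod.swap e \<in> E \<longleftrightarrow> e \<in> E"
  using E_sym by (cases e) auto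

lemma U_eq: "U = lf ` E"
proof
  show "U \<subseteq> lf ` E"
  proof
    fix f assume "f \<in> U"
    then have "{e \<in> E. lf e = f} \<noteq> {}" using boundary[OF \<open>f \<in> U\<close>] unfolding cyclic_on_def by blast
    then show "f \<in> lf ` E" by auto
  qed
qed (use lf_in in auto)

lemma finite_U: "finite U"
  using finite_E by (simp add: U_eq)

lemma fst_sigma: "e \<in> E \<Longrightarrow> \<sigma> e \<in> E \<and> fst (\<sigma> e) = fst e"
  using cyclic_on_inI[OF rotation, of "fst e" e] E_sub by auto

lemma lf_phi: "e \<in> E \<Longrightarrow> lf (\<sigma> (prod.swap e)) = lf e"
  using cyclic_on_inI[OF boundary, of "lf e" e] lf_in by auto

lemma permutes_sigma: "\<sigma> permutes E"
proof -
  have "\<sigma> ` E = E"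
  proof -
    have "e \<in> \<sigma> ` E" if "e \<in> E" for e
    proof -
      have "fst e \<in> V" using that E_sub by auto
      from cyclic_on_surj[OF rotation[OF this]] that show ?thesis by blast
    qed
    then show ?thesis using fst_sigma by auto
  qed
  moreover from this have "inj_on \<sigma> E" using finite_E by (simp add: eq_card_imp_inj_on)
  ultimately show ?thesis using fixed by (intro bij_imp_permutes) (auto simp: bij_betw_def)
qed

text \<open>
  The reflected sphere has the inverse rotation, and each arc takes the boundary walk of its reverse.
\<close>

lemma mirror: "plane_map V U E (inv \<sigma>) (lf \<circ> prod.swap)"
proof
  have inv: "inv \<sigma> (\<sigma> e) = e" for e using permutes_sigma by (rule permutes_inverses)
  show "inv \<sigma> e = e" if "e \<notin> E" for e
    using inv[of e] fixed[OF that] by simp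
  show "cyclic_on (inv \<sigma>) {e \<in> E. fst e = v}" if "v \<in> V" for v
    using rotation[OF that] inv by (rule cyclic_on_inverse)
  show "cyclic_on (inv \<sigma> \<circ> prod.swap) {e \<in> E. (lf \<circ> prod.swap) e = f}" if "f \<in> U" for f
  proof -
    have "cyclic_on (prod.swap \<circ> inv \<sigma>) {e \<in> E. lf e = f}"
      using boundary[OF that] by (rule cyclic_on_inverse) (simp add: inv)
    then have "cyclic_on (inv \<sigma> \<circ> prod.swap) (prod.swap ` {e \<in> E. lf e = f})"
      by (rule cyclic_on_image) simp
    moreover have "prod.swap ` {e \<in> E. lf e = f} = {e \<in> E. (lf \<circ> prod.swap) e = f}"
      using E_sym by force
    ultimately show ?thesis by simp
  qed
  show "(lf \<circ> prod.swap) e \<in> U" if "e \<in> E" for e using lf_in swap_E[of e] that by simp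
qed (use finite_V E_sub E_sym E_irrefl euler in auto)

lemma pair_graph: "pair_graph \<lparr>pverts = V, parcs = E\<rparr>"
  using E_sub finite_V finite_E E_sym E_irrefl
  by unfold_locales (auto simp: symmetric_def intro: symI)

lemma face_of_eq:
  assumes "e \<in> E"
  shows "face_of \<sigma> e = {e' \<in> E. lf e' = lf e}"
  unfolding face_of_def using orbit_cyclic_eq3[OF boundary[OF lf_in[OF assms]], of e] assms by simp

lemma sphere_embedding:
  assumes "connected (with_proj \<lparr>pverts = V, parcs = E\<rparr>)"
  shows "sphere_embedding \<lparr>pverts = V, parcs = E\<rparr> \<sigma>"
proof -
  let ?F = "\<lambda>f. {e' \<in> E. lf e' = f}"
  have "map_faces \<lparr>pverts = V, parcs = E\<rparr> \<sigma> = ?F ` U"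
    unfolding map_faces_def U_eq image_image by (intro image_cong) (auto simp: face_of_eq)
  moreover have "inj_on ?F U"
    unfolding U_eq by (intro inj_onI) blast
  ultimately have "card (map_faces \<lparr>pverts = V, parcs = E\<rparr> \<sigma>) = card U"
    by (simp add: card_image)
  then show ?thesis
    using assms euler permutes_sigma rotation
    by (auto simp: sphere_embedding_def rotation_system_def out_arcs_def)
qed

end

text \<open>
  A self-dual map with a configuration: \<open>A\<close>, \<open>B\<close>, \<open>C\<close> are \<open>\<psi> a\<close>, \<open>\<psi> b\<close>, \<open>\<psi> c\<close>.  The two faces \<open>c B a C\<close>
  and \<open>c A b C\<close> of \<open>R\<close> share the edge \<open>cC\<close>; in \<open>G\<close> this says that \<open>(b, c)\<close> and \<open>(c, a)\<close> are
  consecutive on the boundary of \<open>C\<close>, with \<open>A\<close> and \<open>B\<close> on the other sides.  The condition \<open>corner\<close> is this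
  consecutiveness, and it fixes one of the two orientations of the sphere.
\<close>

locale self_dual_map = plane_map V U E \<sigma> lf
  for V :: "'v set" and U :: "'f set" and E :: "'v rel"
    and \<sigma> :: "'v \<times> 'v \<Rightarrow> 'v \<times> 'v" and lf :: "'v \<times> 'v \<Rightarrow> 'f" +
  fixes \<psi> :: "'v \<Rightarrow> 'f" and a b c :: 'v
  assumes psi_bij: "bij_betw \<psi> V U"
    and dual: "(\<lambda>(u, w). (\<psi> u, \<psi> w)) ` E = (\<lambda>e. (lf e, lf (prod.swap e))) ` E"
    and three: "three_connected V E"
    and a_neq_b: "a \<noteq> b" and ac: "(a, c) \<in> E" and bc: "(b, c) \<in> E"
    and corner: "\<sigma> (c, b) = (c, a)"
    and lf_bc: "lf (b, c) = \<psi> c" and lf_cb: "lf (c, b) = \<psi> a" and lf_ac: "lf (a, c) = \<psi> b"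
begin

lemma connected: "connected (with_proj \<lparr>pverts = V, parcs = E\<rparr>)"
  using three cut_connected_def
  by (intro connected_if_cut_connected[where E = E]) (auto simp: three_connected_def dest: spec[of _ "{}"])

lemma polyhedral: "polyhedral \<lparr>pverts = V, parcs = E\<rparr>"
  unfolding polyhedral_def
  using pair_graph k_vertex_connected_3I[OF three] sphere_embedding[OF connected] by blast

lemma self_dual: "self_dual \<lparr>pverts = V, parcs = E\<rparr>"
proof -
  let ?G = "\<lparr>pverts = V, parcs = E\<rparr>"
  let ?F = "\<lambda>f. {e' \<in> E. lf e' = f}"
  let ?h = "\<lambda>v. ?F (\<psi> v)"
  have injF: "inj_on ?F U" unfolding U_eq by (intro inj_onI) blast
  have inj: "inj_on ?h V"
    using comp_inj_on[of \<psi> V ?F] psi_bij injF by (auto simp: bij_betw_def comp_def)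
  have verts: "?h ` V = map_faces ?G \<sigma>"
  proof -
    have "?h ` V = ?F ` U" using psi_bij by (auto simp: bij_betw_def image_image[symmetric])
    also have "\<dots> = map_faces ?G \<sigma>"
      unfolding map_faces_def U_eq image_image by (intro image_cong) (auto simp: face_of_eq)
    finally show ?thesis .
  qed
  have arcs: "map_prod ?h ?h ` E = parcs (dual_graph ?G \<sigma>)"
  proof -
    have "map_prod ?h ?h ` E = map_prod ?F ?F ` (\<lambda>(u, w). (\<psi> u, \<psi> w)) ` E"
      by (force simp: image_image)
    also have "\<dots> = (\<lambda>e. (?F (lf e), ?F (lf (prod.swap e)))) ` E"
      unfolding dual by (simp add: image_image)
    also have "\<dots> = (\<lambda>e. (face_of \<sigma> e, face_of \<sigma> (prod.swap e))) ` E"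
    proof (intro image_cong refl)
      fix e assume e: "e \<in> E"
      then have "prod.swap e \<in> E" by (simp add: swap_E)
      with e show "(?F (lf e), ?F (lf (prod.swap e))) = (face_of \<sigma> e, face_of \<sigma> (prod.swap e))"
        by (simp add: face_of_eq)
    qed
    finally show ?thesis by (simp add: dual_graph_def)
  qed
  let ?iso = "\<lparr>iso_verts = ?h, iso_arcs = map_prod ?h ?h, iso_head = snd, iso_tail = fst\<rparr>"
  interpret G: pair_graph ?G by (rule pair_graph)
  have "inj_on (map_prod ?h ?h) E"
    using map_prod_inj_on[OF inj inj] E_sub by (rule inj_on_subset)
  then have "pre_digraph.digraph_isomorphism (with_proj ?G) ?iso"
    unfolding G.digraph_isomorphism_def using inj G.wf_digraph by simp
  moreover have "with_proj (dual_graph ?G \<sigma>) = app_iso ?iso (with_proj ?G)"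
    using verts arcs by (simp add: with_proj_def app_iso_def dual_graph_def)
  ultimately have "digraph_iso (with_proj ?G) (with_proj (dual_graph ?G \<sigma>))"
    unfolding digraph_iso_def by blast
  then show ?thesis
    unfolding self_dual_def using sphere_embedding[OF connected] by blast
qed

lemma abc_in_V: "a \<in> V" "b \<in> V" "c \<in> V"
  using ac bc E_sub by auto

lemma c_neq: "c \<noteq> a" "c \<noteq> b"
  using ac bc E_irrefl by auto

lemma ca: "(c, a) \<in> E" and cb: "(c, b) \<in> E"
  using ac bc E_sym by auto

lemma lf_ca: "lf (c, a) = \<psi> c"
  using lf_phi[OF bc] corner lf_bc by simp

lemma psi_inj: "u \<in> V \<Longrightarrow> w \<in> V \<Longrightarrow> \<psi> u = \<psi> w \<longleftrightarrow> u = w"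
  using psi_bij by (auto simp: bij_betw_def dest: inj_onD)

text \<open>
  Two faces share at most one edge: the dual has as many arcs as \<open>G\<close>, being isomorphic to it, so no two
  arcs of \<open>G\<close> can give the same dual arc.
\<close>

lemma inj_on_dual_arc: "inj_on (\<lambda>e. (lf e, lf (prod.swap e))) E"
proof (rule eq_card_imp_inj_on[OF finite_E])
  have "inj_on (\<lambda>(u, w). (\<psi> u, \<psi> w)) E"
    using E_sub psi_inj by (auto simp: inj_on_def)
  then show "card ((\<lambda>e. (lf e, lf (prod.swap e))) ` E) = card E"
    unfolding dual[symmetric] by (rule card_image)
qed

end

text \<open>
  A configuration in which \<open>C\<close> is traversed in the opposite direction, from \<open>a\<close> through \<open>c\<close> to \<open>b\<close>, becomes
  one of the chosen orientation on the reflected sphere, with the same \<open>\<psi>\<close>.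
\<close>

lemma self_dual_map_mirrorI:
  assumes "plane_map V U E \<sigma> lf"
    and "bij_betw \<psi> V U"
    and dual: "(\<lambda>(u, w). (\<psi> u, \<psi> w)) ` E = (\<lambda>e. (lf e, lf (prod.swap e))) ` E"
    and "three_connected V E"
    and "a \<noteq> b" and "(a, c) \<in> E" and "(b, c) \<in> E"
    and corner: "\<sigma> (c, a) = (c, b)"
    and "lf (c, b) = \<psi> c" and "lf (b, c) = \<psi> a" and "lf (c, a) = \<psi> b"
  shows "self_dual_map V U E (inv \<sigma>) (lf \<circ> prod.swap) \<psi> a b c"
proof -
  interpret plane_map V U E \<sigma> lf by fact
  interpret M: plane_map V U E "inv \<sigma>" "lf \<circ> prod.swap" by (rule mirror)
  show ?thesis
  proof
    show "inv \<sigma> (c, b) = (c, a)"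
      using permutes_inverses(2)[OF permutes_sigma, of "(c, a)"] corner by simp
    have "(\<lambda>e. (lf e, lf (prod.swap e))) ` E
        = (\<lambda>e. (lf e, lf (prod.swap e))) ` prod.swap ` E"
      using E_sym by (intro arg_cong[where f = "\<lambda>A. _ ` A"]) force
    then show "(\<lambda>(u, w). (\<psi> u, \<psi> w)) ` E
        = (\<lambda>e. ((lf \<circ> prod.swap) e, (lf \<circ> prod.swap) (prod.swap e))) ` E"
      unfolding dual by (simp add: image_image)
  qed (use assms in auto)
qed

section \<open>The transformation of a self-dual map\<close>

lemma remove_readd:
  assumes "X \<subseteq> A" "X \<inter> P = {}"
  shows "A - (P \<union> X) \<union> (X \<union> R) = A - P \<union> R"
  using assms by blast

text \<open>
  The new vertex \<open>d\<close> on \<open>bc\<close> is joined to \<open>a\<close> across the face \<open>C\<close>.  This cuts off the triangle \<open>a d c\<close>,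
  which becomes the new face \<open>D\<close>; the rest of \<open>C\<close>, on the side of \<open>b\<close>, keeps its name.
\<close>

locale subdivision = self_dual_map V U E \<sigma> lf \<psi> a b c
  for V :: "'v set" and U :: "'f set" and E \<sigma> lf \<psi> a b c +
  fixes d :: 'v and D :: 'f
  assumes d_new: "d \<notin> V" and D_new: "D \<notin> U"
begin

abbreviation "E' \<equiv> subdivide_join E a b c d"

text \<open>
  At \<open>b\<close> and at \<open>c\<close> the new arc to \<open>d\<close> takes the position of the deleted one, which \<open>ren\<close> expresses.
\<close>

definition ren :: "'v \<times> 'v \<Rightarrow> 'v \<times> 'v" where
  "ren = id((b, c) := (b, d), (c, b) := (c, d))"

text \<open>
  The arc \<open>(a, d)\<close> comes right after \<open>(a, c)\<close>, inside the corner of \<open>C\<close>; the three arcs at \<open>d\<close> form a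
  new cycle.  The deleted arcs \<open>(b, c)\<close> and \<open>(c, b)\<close> become fixed points.
\<close>

definition \<sigma>' :: "'v \<times> 'v \<Rightarrow> 'v \<times> 'v" where
  "\<sigma>' = (ren \<circ> \<sigma>)
     ((b, c) := (b, c), (c, b) := (c, b), (b, d) := ren (\<sigma> (b, c)), (c, d) := ren (\<sigma> (c, b)),
      (a, c) := (a, d), (a, d) := \<sigma> (a, c),
      (d, b) := (d, a), (d, a) := (d, c), (d, c) := (d, b))"

definition lf' :: "'v \<times> 'v \<Rightarrow> 'f" where
  "lf' = lf((b, d) := \<psi> c, (d, a) := \<psi> c, (c, d) := \<psi> a, (d, b) := \<psi> a,
     (c, a) := D, (a, d) := D, (d, c) := D)"

definition \<psi>' :: "'v \<Rightarrow> 'f" where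
  "\<psi>' = \<psi>(d := D)"

lemma d_neq: "d \<noteq> a" "d \<noteq> b" "d \<noteq> c" "a \<noteq> d" "b \<noteq> d" "c \<noteq> d"
  using d_new abc_in_V by auto

lemma abc_neq: "a \<noteq> b" "b \<noteq> a" "a \<noteq> c" "c \<noteq> a" "b \<noteq> c" "c \<noteq> b"
  using a_neq_b c_neq by auto

lemmas neqs = d_neq abc_neq

lemma no_d: "(d, x) \<notin> E" "(x, d) \<notin> E"
  using d_new E_sub by auto

lemma psi_in: "\<psi> a \<in> U" "\<psi> b \<in> U" "\<psi> c \<in> U"
  using psi_bij abc_in_V by (auto simp: bij_betw_def)

lemma psi_neq: "\<psi> a \<noteq> \<psi> b" "\<psi> b \<noteq> \<psi> a" "\<psi> a \<noteq> \<psi> c" "\<psi> c \<noteq> \<psi> a" "\<psi> b \<noteq> \<psi> c" "\<psi> c \<noteq> \<psi> b"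
  using psi_inj abc_in_V neqs by auto

lemma D_neq: "D \<noteq> \<psi> a" "D \<noteq> \<psi> b" "D \<noteq> \<psi> c" "\<psi> a \<noteq> D" "\<psi> b \<noteq> D" "\<psi> c \<noteq> D"
  using psi_in D_new by auto

lemma lf_neq_D: "e \<in> E \<Longrightarrow> lf e \<noteq> D"
  using lf_in[of e] D_new by auto

lemma sigma'_old:
  assumes "e \<in> E" "e \<noteq> (b, c)" "e \<noteq> (c, b)" "e \<noteq> (a, c)"
  shows "\<sigma>' e = ren (\<sigma> e)"
proof -
  have "e \<notin> {(b, d), (c, d), (a, d), (d, b), (d, a), (d, c)}" using assms(1) no_d by blast
  then show ?thesis using assms(2-4) by (simp add: \<sigma>'_def)
qed

lemma sigma'_new:
  "\<sigma>' (d, b) = (d, a)" "\<sigma>' (d, a) = (d, c)" "\<sigma>' (d, c) = (d, b)"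
  "\<sigma>' (a, c) = (a, d)" "\<sigma>' (a, d) = \<sigma> (a, c)"
  "\<sigma>' (b, d) = ren (\<sigma> (b, c))" "\<sigma>' (c, d) = (c, a)"
  using neqs corner by (simp_all add: \<sigma>'_def ren_def)

lemma lf'_new:
  "lf' (b, d) = \<psi> c" "lf' (d, a) = \<psi> c" "lf' (c, d) = \<psi> a" "lf' (d, b) = \<psi> a"
  "lf' (c, a) = D" "lf' (a, d) = D" "lf' (d, c) = D"
  using neqs by (simp_all add: lf'_def)

lemma lf'_old:
  assumes "e \<in> E" "e \<noteq> (c, a)"
  shows "lf' e = lf e"
proof -
  have "e \<notin> {(b, d), (c, d), (a, d), (d, b), (d, a), (d, c)}" using assms(1) no_d by blast
  then show ?thesis using assms(2) by (simp add: lf'_def)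
qed

lemma fiber':
  "{e \<in> E'. lf' e = f} = {e \<in> E. lf e = f} - {(b, c), (c, b), (c, a)} \<union>
     (if f = D then {(c, a), (a, d), (d, c)} else {}) \<union>
     (if f = \<psi> a then {(c, d), (d, b)} else {}) \<union>
     (if f = \<psi> c then {(b, d), (d, a)} else {})" (is "_ = ?R")
proof -
  let ?N = "{(c, a), (a, d), (d, c), (c, d), (d, b), (b, d), (d, a)}"
  have E': "E' = E - {(b, c), (c, b), (c, a)} \<union> ?N"
    using ca neqs by (auto simp: subdivide_join_def)
  have old: "{e \<in> E - {(b, c), (c, b), (c, a)}. lf' e = f} =
      {e \<in> E. lf e = f} - {(b, c), (c, b), (c, a)}"
    using lf'_old by auto
  have new: "{e \<in> ?N. lf' e = f} =
      (if f = D then {(c, a), (a, d), (d, c)} else {}) \<union>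
      (if f = \<psi> a then {(c, d), (d, b)} else {}) \<union>
      (if f = \<psi> c then {(b, d), (d, a)} else {})"
  proof -
    have ins: "{e \<in> insert x A. P e} = (if P x then {x} else {}) \<union> {e \<in> A. P e}"
      for x :: "'v \<times> 'v" and A P by auto
    show ?thesis
      unfolding ins lf'_new using psi_neq D_neq
      by (cases "f = D"; cases "f = \<psi> a"; cases "f = \<psi> c") (simp_all add: insert_commute)
  qed
  have split: "{e \<in> A \<union> B. lf' e = f} = {e \<in> A. lf' e = f} \<union> {e \<in> B. lf' e = f}" for A B
    by auto
  show ?thesis unfolding E' split old new by (simp only: Un_assoc)
qed

lemma ren_id: "e \<noteq> (b, c) \<Longrightarrow> e \<noteq> (c, b) \<Longrightarrow> ren e = e"
  by (simp add: ren_def)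

lemma sigma_ac: "\<sigma> (a, c) \<in> E" "fst (\<sigma> (a, c)) = a"
  using fst_sigma[OF ac] by auto

lemma out_arcs':
  shows "{e \<in> E'. fst e = d} = {(d, b), (d, a), (d, c)}"
    and "{e \<in> E'. fst e = a} = insert (a, d) {e \<in> E. fst e = a}"
    and "v \<noteq> a \<Longrightarrow> v \<noteq> d \<Longrightarrow> {e \<in> E'. fst e = v} = ren ` {e \<in> E. fst e = v}"
proof -
  have "{e \<in> E. fst e = d} = {}" using no_d by auto
  then show "{e \<in> E'. fst e = d} = {(d, b), (d, a), (d, c)}"
    unfolding subdivide_join_def using neqs by auto
  show "{e \<in> E'. fst e = a} = insert (a, d) {e \<in> E. fst e = a}"
    unfolding subdivide_join_def using neqs by auto
  show "{e \<in> E'. fst e = v} = ren ` {e \<in> E. fst e = v}" if "v \<noteq> a" "v \<noteq> d"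
    using that bc cb neqs by (force simp: subdivide_join_def ren_def image_iff)
qed

lemma rotation':
  assumes "v \<in> insert d V"
  shows "cyclic_on \<sigma>' {e \<in> E'. fst e = v}"
proof -
  consider "v = d" | "v = a" | "v \<in> V" "v \<noteq> a" "v \<noteq> d"
    using assms d_new by auto
  then show ?thesis
  proof cases
    case 1
    then show ?thesis by (simp add: out_arcs'(1) cyclic_on_3 sigma'_new)
  next
    case 2
    have "cyclic_on \<sigma>' (insert (a, d) {e \<in> E. fst e = a})"
    proof (rule cyclic_on_insert[OF rotation[OF abc_in_V(1)], where x = "(a, c)"])
      fix e assume e: "e \<in> {e \<in> E. fst e = a}" "e \<noteq> (a, c)"
      then have "fst (\<sigma> e) = a" using fst_sigma by simp
      then have "ren (\<sigma> e) = \<sigma> e" using neqs by (intro ren_id) auto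
      moreover have "e \<noteq> (b, c)" "e \<noteq> (c, b)" using e neqs by auto
      ultimately show "\<sigma>' e = \<sigma> e" using e sigma'_old[of e] by simp
    qed (use ac no_d sigma'_new in auto)
    then show ?thesis by (simp only: 2 out_arcs'(2))
  next
    case 3
    have "cyclic_on \<sigma>' (ren ` {e \<in> E. fst e = v})"
    proof (rule cyclic_on_image[OF rotation[OF 3(1)]])
      fix e assume e: "e \<in> {e \<in> E. fst e = v}"
      have ren: "ren (b, c) = (b, d)" "ren (c, b) = (c, d)" "ren (c, a) = (c, a)"
        using neqs by (auto simp: ren_def)
      consider "e = (b, c)" | "e = (c, b)" | "e \<noteq> (b, c)" "e \<noteq> (c, b)" by blast
      then show "\<sigma>' (ren e) = ren (\<sigma> e)"
      proof cases
        case 3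
        moreover have "e \<noteq> (a, c)" using e \<open>v \<noteq> a\<close> by auto
        ultimately show ?thesis using e sigma'_old[of e] by (simp add: ren_id)
      qed (simp_all add: ren sigma'_new corner)
    qed
    then show ?thesis by (simp only: out_arcs'(3)[OF 3(2,3)])
  qed
qed

lemma phi'_old:
  assumes "e \<in> E" "e \<noteq> (b, c)" "e \<noteq> (c, b)" "e \<noteq> (c, a)"
  shows "(\<sigma>' \<circ> prod.swap) e = ren (\<sigma> (prod.swap e))"
  using assms sigma'_old[of "prod.swap e"] swap_E[of e] by (cases e) auto

lemma phi'_new:
  "(\<sigma>' \<circ> prod.swap) (c, d) = (d, b)"
  "(\<sigma>' \<circ> prod.swap) (d, b) = ren (\<sigma> (b, c))"
  "(\<sigma>' \<circ> prod.swap) (b, d) = (d, a)"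
  "(\<sigma>' \<circ> prod.swap) (d, a) = \<sigma> (a, c)"
  "(\<sigma>' \<circ> prod.swap) (c, a) = (a, d)"
  "(\<sigma>' \<circ> prod.swap) (a, d) = (d, c)"
  "(\<sigma>' \<circ> prod.swap) (d, c) = (c, a)"
  by (simp_all add: sigma'_new)

text \<open>
  The walk around \<open>A\<close> passes \<open>(c, d)\<close>, \<open>(d, b)\<close> in place of \<open>(c, b)\<close>; the walk around \<open>C\<close> passes
  \<open>(b, d)\<close>, \<open>(d, a)\<close> in place of \<open>(b, c)\<close>, \<open>(c, a)\<close>; the triangle \<open>D\<close> is a new walk; all others are
  as before.
\<close>

lemma boundary':
  assumes "f \<in> insert D U"
  shows "cyclic_on (\<sigma>' \<circ> prod.swap) {e \<in> E'. lf' e = f}"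
proof -
  let ?\<phi> = "\<sigma> \<circ> prod.swap" and ?\<phi>' = "\<sigma>' \<circ> prod.swap"
  have phi_lf: "lf (\<sigma> (prod.swap e)) = lf e" if "e \<in> E" for e using lf_phi[OF that] .
  consider "f = D" | "f = \<psi> a" | "f = \<psi> c" | "f \<in> U" "f \<noteq> \<psi> a" "f \<noteq> \<psi> c" "f \<noteq> D"
    using assms D_new by auto
  then show ?thesis
  proof cases
    case 1
    have none: "{e \<in> E. lf e = D} = {}" using lf_neq_D by auto
    have "{e \<in> E'. lf' e = f} = {(c, a), (a, d), (d, c)}"
      unfolding fiber' 1 none using D_neq by simp
    then show ?thesis using cyclic_on_3[OF phi'_new(5-7)] by (simp only:)
  next
    case 2
    let ?S = "{e \<in> E. lf e = \<psi> a}"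
    let ?h = "id((c, b) := (c, d))"
    have bc_S: "(b, c) \<notin> ?S" and ca_S: "(c, a) \<notin> ?S" using lf_bc lf_ca psi_neq by auto
    \<comment> \<open>the boundary walk with the renamed arc, before the second half is inserted\<close>
    have "cyclic_on (?\<phi>'((c, d) := ren (\<sigma> (b, c)))) (?h ` ?S)"
    proof (rule cyclic_on_image[OF boundary[OF psi_in(1)]])
      fix e assume e: "e \<in> ?S"
      have "\<sigma> (prod.swap e) \<noteq> (b, c)" using phi_lf[of e] e bc bc_S by auto
      then have *: "ren (\<sigma> (prod.swap e)) = ?h (\<sigma> (prod.swap e))" by (auto simp: ren_def)
      show "(?\<phi>'((c, d) := ren (\<sigma> (b, c)))) (?h e) = ?h (?\<phi> e)"
      proof (cases "e = (c, b)")
        case True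
        then show ?thesis using * by simp
      next
        case False
        have "e \<noteq> (b, c)" "e \<noteq> (c, a)" "e \<noteq> (c, d)" using e bc_S ca_S no_d by blast+
        then show ?thesis using False e * phi'_old[of e] by simp
      qed
    qed
    then have "cyclic_on ?\<phi>' (insert (d, b) (?h ` ?S))"
      by (rule cyclic_on_insert[where x = "(c, d)"])
        (use cb lf_cb no_d neqs phi'_new in \<open>auto simp: image_iff split: if_splits\<close>)
    moreover have "{e \<in> E'. lf' e = f} = insert (d, b) (?h ` ?S)"
    proof -
      have "?h ` ?S = insert (c, d) (?S - {(c, b)})" using cb lf_cb by auto
      then show ?thesis unfolding fiber' using 2 psi_neq D_neq bc_S ca_S by auto
    qed
    ultimately show ?thesis by simp
  next
    case 3
    let ?S = "{e \<in> E. lf e = \<psi> c}"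
    let ?h = "id((b, c) := (b, d), (c, a) := (d, a))"
    have cb_S: "(c, b) \<notin> ?S" using lf_cb psi_neq by auto
    have "cyclic_on ?\<phi>' (?h ` ?S)"
    proof (rule cyclic_on_image[OF boundary[OF psi_in(3)]])
      fix e assume e: "e \<in> ?S"
      consider "e = (b, c)" | "e = (c, a)" | "e \<noteq> (b, c)" "e \<noteq> (c, a)" by blast
      then show "?\<phi>' (?h e) = ?h (?\<phi> e)"
      proof cases
        case 1
        then show ?thesis using neqs corner phi'_new by simp
      next
        case 2
        have "\<sigma> (a, c) \<noteq> (b, c)" "\<sigma> (a, c) \<noteq> (c, a)" using sigma_ac neqs by auto
        then show ?thesis using 2 neqs phi'_new by simp
      next
        case 3
        have "\<sigma> (prod.swap e) \<noteq> (c, b)" using phi_lf[of e] e cb cb_S by auto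
        moreover have "\<sigma> (prod.swap e) \<noteq> (c, a)"
        proof
          assume "\<sigma> (prod.swap e) = (c, a)"
          then have "prod.swap e = (c, b)"
            using corner permutes_inj[OF permutes_sigma] by (metis injD)
          then show False using 3 by (cases e) auto
        qed
        ultimately have "ren (\<sigma> (prod.swap e)) = ?h (\<sigma> (prod.swap e))" by (auto simp: ren_def)
        moreover have "e \<noteq> (c, b)" using e cb_S by blast
        ultimately show ?thesis using 3 e phi'_old[of e] by simp
      qed
    qed
    moreover have "{e \<in> E'. lf' e = f} = ?h ` ?S"
    proof -
      have "?h ` ?S = {(b, d), (d, a)} \<union> (?S - {(b, c), (c, a)})"
        using bc lf_bc ca lf_ca neqs by auto
      then show ?thesis unfolding fiber' using 3 psi_neq D_neq cb_S by auto
    qed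
    ultimately show ?thesis by simp
  next
    case 4
    let ?S = "{e \<in> E. lf e = f}"
    have S: "(b, c) \<notin> ?S" "(c, b) \<notin> ?S" "(c, a) \<notin> ?S" using 4 lf_bc lf_cb lf_ca by auto
    have "cyclic_on ?\<phi>' (id ` ?S)"
    proof (rule cyclic_on_image[OF boundary[OF 4(1)]])
      fix e assume e: "e \<in> ?S"
      have "\<sigma> (prod.swap e) \<noteq> (b, c)" "\<sigma> (prod.swap e) \<noteq> (c, b)" using phi_lf[of e] e bc cb S by auto
      moreover have "e \<noteq> (b, c)" "e \<noteq> (c, b)" "e \<noteq> (c, a)" using e S by blast+
      ultimately show "?\<phi>' (id e) = id (?\<phi> e)" using e phi'_old[of e] by (simp add: ren_id)
    qed
    moreover have "{e \<in> E'. lf' e = f} = ?S"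
      unfolding fiber' using 4 S by auto
    ultimately show ?thesis by simp
  qed
qed

lemma card_E': "card E' = card E + 4"
proof -
  have "card (E - {(b, c), (c, b)}) = card E - 2"
    using bc cb neqs by (subst card_Diff_subset) auto
  moreover have "card {(b, c), (c, b)} \<le> card E"
    using bc cb finite_E by (intro card_mono) auto
  moreover have "card E' = card (E - {(b, c), (c, b)})
      + card {(b, d), (d, b), (c, d), (d, c), (a, d), (d, a)}"
    unfolding subdivide_join_def
    using no_d finite_E by (intro card_Un_disjoint) auto
  moreover have "card {(b, d), (d, b), (c, d), (d, c), (a, d), (d, a)} = 6"
    using neqs by simp
  ultimately show ?thesis using neqs by simp
qed

lemma plane_map': "plane_map (insert d V) (insert D U) E' \<sigma>' lf'"
proof
  show "\<sigma>' e = e" if "e \<notin> E'" for e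
  proof -
    have e: "e \<notin> {(b, d), (d, b), (c, d), (d, c), (a, d), (d, a), (a, c)}"
      using that ac neqs by (auto simp: subdivide_join_def)
    show ?thesis
    proof (cases "e = (b, c) \<or> e = (c, b)")
      case True
      then show ?thesis using neqs by (auto simp: \<sigma>'_def)
    next
      case False
      then have "e \<notin> E" using that by (auto simp: subdivide_join_def)
      then show ?thesis using False e fixed[of e] by (auto simp: \<sigma>'_def ren_def)
    qed
  qed
  show "lf' e \<in> insert D U" if "e \<in> E'" for e
    using that psi_in lf_in[of e] by (auto simp: subdivide_join_def lf'_def)
  show "card (insert d V) + card (insert D U) = card E' div 2 + 2"
    using euler card_E' finite_V finite_U d_new D_new by simp
qed (use finite_V E_sub E_sym E_irrefl abc_in_V neqs rotation' boundary'
      in \<open>auto simp: subdivide_join_def\<close>)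

lemma psi'_bij: "bij_betw \<psi>' (insert d V) (insert D U)"
proof -
  have "bij_betw \<psi>' V U"
    using psi_bij d_new by (subst bij_betw_cong[where g = \<psi>]) (auto simp: \<psi>'_def)
  moreover have "\<psi>' d = D" by (simp add: \<psi>'_def)
  ultimately show ?thesis using notIn_Un_bij_betw[of d V \<psi>' U] d_new D_new by simp
qed

text \<open>
  The dual loses \<open>BC\<close>, since the edge \<open>ac\<close> now separates \<open>B\<close> from \<open>D\<close>, and gains \<open>BD\<close>, \<open>CD\<close>, \<open>AD\<close>:
  the image under \<open>\<psi>'\<close> of what happens to \<open>G\<close>.  That \<open>ac\<close> was the only edge between \<open>B\<close> and \<open>C\<close> is
  \<open>inj_on_dual_arc\<close>.
\<close>

lemma dual': "(\<lambda>(u, w). (\<psi>' u, \<psi>' w)) ` E' = (\<lambda>e. (lf' e, lf' (prod.swap e))) ` E'"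
proof -
  let ?p = "\<lambda>(u, w). (\<psi> u, \<psi> w)" and ?p' = "\<lambda>(u, w). (\<psi>' u, \<psi>' w)"
  let ?l = "\<lambda>e. (lf e, lf (prod.swap e))" and ?l' = "\<lambda>e. (lf' e, lf' (prod.swap e))"
  let ?Ed = "(\<lambda>(u, w). (\<psi> u, \<psi> w)) ` E"
  have psid: "\<psi>' d = D" "\<psi>' a = \<psi> a" "\<psi>' b = \<psi> b" "\<psi>' c = \<psi> c"
    using neqs by (auto simp: \<psi>'_def)
  have "?p' ` (E - {(b, c), (c, b)}) = ?p ` (E - {(b, c), (c, b)})"
  proof (intro image_cong refl)
    fix e assume "e \<in> E - {(b, c), (c, b)}"
    then have "fst e \<noteq> d" "snd e \<noteq> d" using E_sub d_new by auto
    then show "?p' e = ?p e" by (cases e) (simp add: \<psi>'_def)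
  qed
  also have "\<dots> = ?Ed - ?p ` {(b, c), (c, b)}"
    using bc cb E_sub psi_inj by (intro inj_on_image_set_diff[where C = E]) (auto simp: inj_on_def)
  finally have "?p' ` E' = ?Ed - {(\<psi> b, \<psi> c), (\<psi> c, \<psi> b)} \<union>
      {(\<psi> b, D), (D, \<psi> b), (\<psi> c, D), (D, \<psi> c), (\<psi> a, D), (D, \<psi> a)}"
    by (simp add: subdivide_join_def image_Un psid)
  moreover have "?l' ` E' = \<dots>"
  proof -
    \<comment> \<open>outside \<open>?K\<close> both the arcs and the faces on their sides are unchanged\<close>
    let ?K = "{(a, c), (c, a), (b, c), (c, b)}"
    have "?l' ` (E - ?K) = ?l ` (E - ?K)"
    proof (intro image_cong refl)
      fix e assume e: "e \<in> E - ?K"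
      then have "prod.swap e \<in> E" "prod.swap e \<noteq> (c, a)"
        by (simp add: swap_E, cases e) auto
      with e show "?l' e = ?l e" by (simp add: lf'_old)
    qed
    also have "\<dots> = ?Ed - ?l ` ?K"
      unfolding dual using ac ca bc cb
      by (intro inj_on_image_set_diff[OF inj_on_dual_arc]) auto
    also have "?l ` ?K = {(\<psi> b, \<psi> c), (\<psi> c, \<psi> b)} \<union> {(\<psi> c, \<psi> a), (\<psi> a, \<psi> c)}"
      by (auto simp: lf_ac lf_ca lf_bc lf_cb)
    finally have old: "?l' ` (E - ?K) = ?Ed - \<dots>" .
    have "E' = (E - ?K) \<union> {(a, c), (c, a), (b, d), (d, b), (c, d), (d, c), (a, d), (d, a)}"
      using ac ca neqs by (auto simp: subdivide_join_def)
    then have "?l' ` E' = ?l' ` (E - ?K) \<union>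
        ?l' ` {(a, c), (c, a), (b, d), (d, b), (c, d), (d, c), (a, d), (d, a)}"
      by (simp only: image_Un)
    also have "?l' ` {(a, c), (c, a), (b, d), (d, b), (c, d), (d, c), (a, d), (d, a)} =
        {(\<psi> c, \<psi> a), (\<psi> a, \<psi> c)} \<union>
        {(\<psi> b, D), (D, \<psi> b), (\<psi> c, D), (D, \<psi> c), (\<psi> a, D), (D, \<psi> a)}"
      using neqs by (auto simp: lf'_def lf_ac)
    also have "(?l' ` (E - ?K)) \<union> \<dots> = ?Ed - {(\<psi> b, \<psi> c), (\<psi> c, \<psi> b)} \<union>
        {(\<psi> b, D), (D, \<psi> b), (\<psi> c, D), (D, \<psi> c), (\<psi> a, D), (D, \<psi> a)}"
      unfolding old
    proof (rule remove_readd)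
      show "{(\<psi> c, \<psi> a), (\<psi> a, \<psi> c)} \<subseteq> ?Ed" using ac ca by force
    qed (use psi_neq in auto)
    finally show ?thesis .
  qed
  ultimately show ?thesis by simp
qed

lemma three': "three_connected (insert d V) E'"
  using three finite_V abc_in_V abc_neq d_new by (intro three_connected_subdivide_join) auto

text \<open>
  Both relabellings use the new triangle \<open>D\<close> as the next face \<open>C\<close> and its corner at \<open>d\<close>.  Going around \<open>D\<close>,
  \<open>(a, d)\<close> is followed by \<open>(d, c)\<close>.  With the labels \<open>(c, a, d)\<close> this is the orientation of
  \<open>self_dual_map\<close>, with the labels \<open>(a, c, d)\<close> the opposite one.
\<close>

lemma last_config: "self_dual_map (insert d V) (insert D U) E' \<sigma>' lf' \<psi>' c a d"
  using psi'_bij dual' three' neqs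
  by (intro self_dual_map.intro plane_map' self_dual_map_axioms.intro)
    (auto simp: subdivide_join_def \<sigma>'_def lf'_def \<psi>'_def)

lemma between_config:
  "self_dual_map (insert d V) (insert D U) E' (inv \<sigma>') (lf' \<circ> prod.swap) \<psi>' a c d"
  using psi'_bij dual' three' neqs
  by (intro self_dual_map_mirrorI plane_map')
    (auto simp: subdivide_join_def \<sigma>'_def lf'_def \<psi>'_def)

end

definition deg :: "'v rel \<Rightarrow> 'v \<Rightarrow> nat" where
  "deg E v = card {e \<in> E. fst e = v}"

context subdivision
begin

lemma deg':
  "deg E' d = 3"
  "deg E' a = Suc (deg E a)"
  "v \<noteq> a \<Longrightarrow> v \<noteq> d \<Longrightarrow> deg E' v = deg E v"
proof -
  show "deg E' d = 3" using neqs by (simp add: deg_def out_arcs')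
  show "deg E' a = Suc (deg E a)" using no_d finite_E by (simp add: deg_def out_arcs')
  show "deg E' v = deg E v" if "v \<noteq> a" "v \<noteq> d"
  proof -
    have "inj_on ren {e \<in> E. fst e = v}"
    proof (rule inj_on_inverseI)
      fix e assume "e \<in> {e \<in> E. fst e = v}"
      then have "e \<noteq> (b, d)" "e \<noteq> (c, d)" using no_d by blast+
      then show "(id((b, d) := (b, c), (c, d) := (c, b))) (ren e) = e"
        using neqs by (simp add: ren_def)
    qed
    then show ?thesis by (simp add: deg_def out_arcs'(3)[OF that] card_image)
  qed
qed

end

section \<open>The faces of the radial graph\<close>

text \<open>The face of the radial graph belonging to an edge of \<open>G\<close>.\<close>

definition quad :: "('v \<times> 'v \<Rightarrow> 'v) \<Rightarrow> 'v \<times> 'v \<Rightarrow> 'v set" where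
  "quad lf e = {fst e, snd e, lf e, lf (prod.swap e)}"

lemma quad_eq_iff:
  assumes "plane_map V U E \<sigma> lf" "V \<inter> U = {}" "e \<in> E" "e' \<in> E"
  shows "quad lf e = quad lf e' \<longleftrightarrow> e = e' \<or> e = prod.swap e'"
proof
  interpret plane_map V U E \<sigma> lf by fact
  have V: "quad lf e \<inter> V = {fst e, snd e}" if "e \<in> E" for e
  proof -
    have "lf e \<notin> V" "lf (prod.swap e) \<notin> V"
      using that lf_in[of e] lf_in[of "prod.swap e"] swap_E[of e] assms(2) by auto
    then show ?thesis using that E_sub by (auto simp: quad_def)
  qed
  assume "quad lf e = quad lf e'"
  then have "{fst e, snd e} = {fst e', snd e'}" using V assms(3,4) by metis
  then show "e = e' \<or> e = prod.swap e'" by (cases e; cases e') (auto simp: doubleton_eq_iff)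
qed (auto simp: quad_def)

lemma image_Diff_iff:
  assumes "\<And>e. e \<in> A \<Longrightarrow> f e \<in> Y \<longleftrightarrow> e \<in> K"
  shows "f ` (A - K) = f ` A - Y"
  using assms by blast

text \<open>
  In the radial graph, vertices and faces of \<open>G\<close> are vertices of one and the same graph and must differ.
\<close>

locale quad_subdivision = subdivision V U E \<sigma> lf \<psi> a b c d D
  for V U :: "'v set" and E \<sigma> lf \<psi> a b c d D +
  assumes disjoint: "insert d V \<inter> insert D U = {}"
begin

lemma quad_ac: "quad lf (a, c) = {c, \<psi> b, a, \<psi> c}"
  and quad_bc: "quad lf (b, c) = {c, \<psi> a, b, \<psi> c}"
  by (auto simp: quad_def lf_ac lf_ca lf_bc lf_cb)

lemma quad_swap: "quad l (prod.swap e) = quad l e"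
  by (auto simp: quad_def)

text \<open>
  On the radial graph the step is the one of the algorithm: the two faces at the edge \<open>cC\<close> give way to the
  four faces inside the hexagon \<open>a B c A b C\<close>.
\<close>

lemma quad': "quad lf' ` E' = (quad lf ` E - {quad lf (a, c), quad lf (b, c)}) \<union>
  {{a, \<psi> c, d, D}, {d, \<psi> a, b, \<psi> c}, {c, \<psi> a, d, D}, {a, \<psi> b, c, D}}"
proof -
  let ?K = "{(a, c), (c, a), (b, c), (c, b)}"
  have E': "E' = (E - ?K) \<union> {(a, d), (d, a), (b, d), (d, b), (c, d), (d, c), (a, c), (c, a)}"
    using ac ca neqs by (auto simp: subdivide_join_def)
  have new: "quad lf' (a, d) = {a, \<psi> c, d, D}" "quad lf' (b, d) = {d, \<psi> a, b, \<psi> c}"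
    "quad lf' (c, d) = {c, \<psi> a, d, D}" "quad lf' (a, c) = {a, \<psi> b, c, D}"
    using lf'_old[OF ac] neqs lf_ac by (auto simp: quad_def lf'_new)
  have flip: "quad lf' (x, y) = quad lf' (y, x)" for x y
    using quad_swap[of lf' "(x, y)"] by simp
  have "quad lf' ` (E - ?K) = quad lf ` (E - ?K)"
  proof (intro image_cong refl)
    fix e assume e: "e \<in> E - ?K"
    then have "prod.swap e \<in> E" "prod.swap e \<noteq> (c, a)"
      by (simp add: swap_E, cases e) auto
    with e show "quad lf' e = quad lf e" by (simp add: quad_def lf'_old)
  qed
  also have "\<dots> = quad lf ` E - {quad lf (a, c), quad lf (b, c)}"
  proof (rule image_Diff_iff)
    fix e assume e: "e \<in> E"
    have "V \<inter> U = {}" using disjoint by auto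
    from quad_eq_iff[OF plane_map_axioms this e]
    show "quad lf e \<in> {quad lf (a, c), quad lf (b, c)} \<longleftrightarrow> e \<in> ?K"
      using ac bc by simp
  qed
  finally have old: "quad lf' ` (E - ?K) = \<dots>" .
  show ?thesis
    unfolding E' image_Un old image_insert image_empty flip[of d] flip[of c a] new
    by (simp only: insert_absorb2)
qed

end

section \<open>The tetrahedron\<close>

definition complete_arcs :: "'v set \<Rightarrow> 'v rel" where
  "complete_arcs V = {(u, w). u \<in> V \<and> w \<in> V \<and> u \<noteq> w}"

lemma complete_arcs_4:
  assumes "distinct [a, b, c, x]"
  shows "complete_arcs {a, b, c, x} = {(a, b), (b, a), (a, c), (c, a), (b, c), (c, b),
      (a, x), (x, a), (b, x), (x, b), (c, x), (x, c)}"
  using assms by (auto simp: complete_arcs_def)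

text \<open>
  The vertex \<open>x\<close> is the one without a label.  The faces \<open>A\<close>, \<open>B\<close>, \<open>C\<close> are opposite to \<open>a\<close>, \<open>b\<close>, \<open>x\<close>, and
  \<open>X\<close> is opposite to \<open>c\<close>.  So \<open>\<psi>\<close> does not send every vertex to the opposite face: it interchanges the
  roles of \<open>c\<close> and \<open>x\<close>, because \<open>C\<close> must be incident with \<open>c\<close>.
\<close>

lemma tetrahedron:
  fixes a b c x A B C X :: 'v
  assumes dist: "distinct [a, b, c, x]" and Dist: "distinct [A, B, C, X]"
  shows "\<exists>\<sigma> lf \<psi>. self_dual_map {a, b, c, x} {A, B, C, X} (complete_arcs {a, b, c, x}) \<sigma> lf \<psi> a b c \<and>
    \<psi> a = A \<and> \<psi> b = B \<and> \<psi> c = C \<and>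
    quad lf ` complete_arcs {a, b, c, x} =
      {{a, b, C, X}, {a, c, B, C}, {b, c, A, C}, {a, x, B, X}, {b, x, A, X}, {c, x, A, B}}"
proof -
  let ?V = "{a, b, c, x}" and ?U = "{A, B, C, X}"
  define E where "E = complete_arcs ?V"
  define \<sigma> where "\<sigma> = id(
    (a, b) := (a, x), (a, x) := (a, c), (a, c) := (a, b),
    (b, a) := (b, c), (b, c) := (b, x), (b, x) := (b, a),
    (c, a) := (c, x), (c, x) := (c, b), (c, b) := (c, a),
    (x, a) := (x, b), (x, b) := (x, c), (x, c) := (x, a))"
  define lf where "lf = (\<lambda>_. A)(
    (a, b) := C, (b, c) := C, (c, a) := C,
    (c, b) := A, (b, x) := A, (x, c) := A,
    (a, c) := B, (c, x) := B, (x, a) := B,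
    (b, a) := X, (a, x) := X, (x, b) := X)"
  define \<psi> where "\<psi> = id(a := A, b := B, c := C, x := X)"
  have neq: "a \<noteq> b" "b \<noteq> a" "a \<noteq> c" "c \<noteq> a" "a \<noteq> x" "x \<noteq> a"
    "b \<noteq> c" "c \<noteq> b" "b \<noteq> x" "x \<noteq> b" "c \<noteq> x" "x \<noteq> c"
    using dist by auto
  have Neq: "A \<noteq> B" "B \<noteq> A" "A \<noteq> C" "C \<noteq> A" "A \<noteq> X" "X \<noteq> A"
    "B \<noteq> C" "C \<noteq> B" "B \<noteq> X" "X \<noteq> B" "C \<noteq> X" "X \<noteq> C"
    using Dist by auto
  have E: "E = {(a, b), (b, a), (a, c), (c, a), (b, c), (c, b),
      (a, x), (x, a), (b, x), (x, b), (c, x), (x, c)}"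
    unfolding E_def using dist by (rule complete_arcs_4)
  have sigma: "\<sigma> (a, b) = (a, x)" "\<sigma> (a, x) = (a, c)" "\<sigma> (a, c) = (a, b)"
    "\<sigma> (b, a) = (b, c)" "\<sigma> (b, c) = (b, x)" "\<sigma> (b, x) = (b, a)"
    "\<sigma> (c, a) = (c, x)" "\<sigma> (c, x) = (c, b)" "\<sigma> (c, b) = (c, a)"
    "\<sigma> (x, a) = (x, b)" "\<sigma> (x, b) = (x, c)" "\<sigma> (x, c) = (x, a)"
    using neq by (simp_all add: \<sigma>_def)
  have lf: "lf (a, b) = C" "lf (b, c) = C" "lf (c, a) = C"
    "lf (c, b) = A" "lf (b, x) = A" "lf (x, c) = A"
    "lf (a, c) = B" "lf (c, x) = B" "lf (x, a) = B"
    "lf (b, a) = X" "lf (a, x) = X" "lf (x, b) = X"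
    using neq by (simp_all add: lf_def)
  have psi: "\<psi> a = A" "\<psi> b = B" "\<psi> c = C" "\<psi> x = X"
    using neq by (simp_all add: \<psi>_def)
  have filter: "{e \<in> insert y Y. P e} = (if P y then {y} else {}) \<union> {e \<in> Y. P e}"
    for y :: "'v \<times> 'v" and Y P by auto
  have rot: "cyclic_on \<sigma> {e \<in> E. fst e = v}" if "v \<in> ?V" for v
  proof -
    have "{e \<in> E. fst e = a} = {(a, b), (a, x), (a, c)}"
         "{e \<in> E. fst e = b} = {(b, a), (b, c), (b, x)}"
         "{e \<in> E. fst e = c} = {(c, a), (c, x), (c, b)}"
         "{e \<in> E. fst e = x} = {(x, a), (x, b), (x, c)}"
      unfolding E filter using neq by auto
    then show ?thesis using that by (auto intro!: cyclic_on_3 simp: sigma)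
  qed
  have bnd: "cyclic_on (\<sigma> \<circ> prod.swap) {e \<in> E. lf e = f}" if "f \<in> ?U" for f
  proof -
    have "{e \<in> E. lf e = A} = {(c, b), (b, x), (x, c)}"
         "{e \<in> E. lf e = B} = {(a, c), (c, x), (x, a)}"
         "{e \<in> E. lf e = C} = {(a, b), (b, c), (c, a)}"
         "{e \<in> E. lf e = X} = {(b, a), (a, x), (x, b)}"
      unfolding E filter lf using Neq by auto
    then show ?thesis using that by (auto intro!: cyclic_on_3 simp: sigma)
  qed
  have "self_dual_map ?V ?U E \<sigma> lf \<psi> a b c"
  proof
    show "\<sigma> e = e" if "e \<notin> E" for e
      using that unfolding E \<sigma>_def by simp
    show "lf e \<in> ?U" if "e \<in> E" for e using that lf unfolding E by auto
    show "card ?V + card ?U = card E div 2 + 2"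
      using neq Neq by (simp add: E)
    show "bij_betw \<psi> ?V ?U"
      using neq Neq psi by (auto simp: bij_betw_def inj_on_def)
    show "(\<lambda>(u, w). (\<psi> u, \<psi> w)) ` E = (\<lambda>e. (lf e, lf (prod.swap e))) ` E"
      unfolding E by (simp add: psi lf) blast
    show "three_connected ?V E"
      using neq by (intro three_connected_complete) (auto simp: E_def complete_arcs_def)
  qed (use rot bnd sigma lf psi neq in \<open>auto simp: E_def complete_arcs_def\<close>)
  moreover have "quad lf ` E =
      {{a, b, C, X}, {a, c, B, C}, {b, c, A, C}, {a, x, B, X}, {b, x, A, X}, {c, x, A, B}}"
  proof -
    have flip: "quad lf (y, z) = quad lf (z, y)" for y z by (auto simp: quad_def)
    have "quad lf (a, b) = {a, b, C, X}" "quad lf (a, c) = {a, c, B, C}" "quad lf (b, c) = {b, c, A, C}"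
      "quad lf (a, x) = {a, x, B, X}" "quad lf (b, x) = {b, x, A, X}" "quad lf (c, x) = {c, x, A, B}"
      by (auto simp: quad_def lf)
    then show ?thesis
      unfolding E image_insert image_empty flip[of b a] flip[of c a] flip[of c b] flip[of x] by (simp only: insert_absorb2)
  qed
  ultimately show ?thesis using psi unfolding E_def by blast
qed

section \<open>The states of the algorithm\<close>

text \<open>
  The invariant of the loop.  The list of faces is duplicate-free so that deleting a face removes it
  from the set of faces, and its length is the number \<open>2 n - 2\<close> of edges of a self-dual plane graph of
  order \<open>n\<close>, which is what the output phase costs.
\<close>

definition represents :: "state \<Rightarrow> nat \<Rightarrow> rvertex rel \<Rightarrow> rvertex \<Rightarrow> rvertex \<Rightarrow> rvertex \<Rightarrow> bool" where
  "represents s n E a b c \<longleftrightarrow>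
     nlow s = n \<and> nup s = n \<and> outp s = \<lparr>pverts = {}, parcs = {}\<rparr> \<and>
     distinct (rfaces s) \<and> length (rfaces s) + 2 = 2 * n \<and>
     lab s La = a \<and> lab s Lb = b \<and> lab s Lc = c \<and>
     (\<exists>\<sigma> lf \<psi>. self_dual_map (Lo ` {..<n}) (Up ` {..<n}) E \<sigma> lf \<psi> a b c \<and>
        set (rfaces s) = quad lf ` E \<and>
        lab s UA = \<psi> a \<and> lab s UB = \<psi> b \<and> lab s UC = \<psi> c)"

lemma exec_transform_P:
  fixes s :: state
  defines "s' \<equiv> fold exec transform_P s"
    and "d \<equiv> Lo (nlow s)" and "D \<equiv> Up (nup s)"
    and "a \<equiv> lab s La" and "b \<equiv> lab s Lb" and "c \<equiv> lab s Lc"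
    and "A \<equiv> lab s UA" and "B \<equiv> lab s UB" and "C \<equiv> lab s UC"
  shows "nlow s' = Suc (nlow s)" "nup s' = Suc (nup s)" "outp s' = outp s"
    "lab s' = (lab s)(Ld := d, UD := D)"
    "rfaces s' = {a, C, d, D} # {d, A, b, C} # {c, A, d, D} # {a, B, c, D} #
       remove1 {c, A, b, C} (remove1 {c, B, a, C} (rfaces s))"
  by (simp_all add: assms transform_P_def)

lemma exec_relabel_between:
  fixes s :: state
  defines "s' \<equiv> fold exec relabel_between s"
  shows "nlow s' = nlow s" "nup s' = nup s" "outp s' = outp s" "rfaces s' = rfaces s"
    "lab s' La = lab s La" "lab s' Lb = lab s Lc" "lab s' Lc = lab s Ld"
    "lab s' UA = lab s UA" "lab s' UB = lab s UC" "lab s' UC = lab s UD"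
  by (simp_all add: assms relabel_between_def)

lemma exec_relabel_last:
  fixes s :: state
  defines "s' \<equiv> fold exec relabel_last s"
  shows "nlow s' = nlow s" "nup s' = nup s" "outp s' = outp s" "rfaces s' = rfaces s"
    "lab s' La = lab s Lc" "lab s' Lb = lab s La" "lab s' Lc = lab s Ld"
    "lab s' UA = lab s UC" "lab s' UB = lab s UA" "lab s' UC = lab s UD"
  by (simp_all add: assms relabel_last_def)

lemma set_remove1_remove1:
  assumes "distinct xs"
  shows "set (remove1 y (remove1 x xs)) = set xs - {x, y}"
    and "distinct (remove1 y (remove1 x xs))"
    and "x \<in> set xs \<Longrightarrow> y \<in> set xs \<Longrightarrow> x \<noteq> y \<Longrightarrow> length (remove1 y (remove1 x xs)) + 2 = length xs"
proof -
  show "length (remove1 y (remove1 x xs)) + 2 = length xs" if "x \<in> set xs" "y \<in> set xs" "x \<noteq> y"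
  proof -
    have "y \<in> set (remove1 x xs)" using that assms by simp
    moreover have "card {x, y} \<le> card (set xs)" using that by (intro card_mono) auto
    ultimately show ?thesis using that assms by (simp add: length_remove1 distinct_card)
  qed
qed (use assms in auto)

lemma represents_transform_P:
  fixes s :: state
  assumes rep: "represents s n E a b c"
  defines "E' \<equiv> subdivide_join E a b c (Lo n)"
  shows "represents (fold exec relabel_between (fold exec transform_P s)) (Suc n) E' a c (Lo n)"
    and "represents (fold exec relabel_last (fold exec transform_P s)) (Suc n) E' c a (Lo n)"
    and "v = Lo n \<or> v \<in> Lo ` {..<n} \<Longrightarrow>
      deg E' v = (if v = Lo n then 3 else if v = a then Suc (deg E a) else deg E v)"
    and "a \<in> Lo ` {..<n}" "c \<in> Lo ` {..<n}" "a \<noteq> c"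
proof -
  obtain \<sigma> lf \<psi> where sdm: "self_dual_map (Lo ` {..<n}) (Up ` {..<n}) E \<sigma> lf \<psi> a b c"
    and faces: "set (rfaces s) = quad lf ` E"
    and upper: "lab s UA = \<psi> a" "lab s UB = \<psi> b" "lab s UC = \<psi> c"
    using rep unfolding represents_def by blast
  have s: "nlow s = n" "nup s = n" "outp s = \<lparr>pverts = {}, parcs = {}\<rparr>" "distinct (rfaces s)"
      "length (rfaces s) + 2 = 2 * n" "lab s La = a" "lab s Lb = b" "lab s Lc = c"
    using rep unfolding represents_def by blast+
  interpret self_dual_map "Lo ` {..<n}" "Up ` {..<n}" E \<sigma> lf \<psi> a b c by (rule sdm)
  interpret quad_subdivision "Lo ` {..<n}" "Up ` {..<n}" E \<sigma> lf \<psi> a b c "Lo n" "Up n"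
    by unfold_locales auto
  let ?d = "Lo n" and ?D = "Up n"
  define s1 where "s1 = fold exec transform_P s"
  note s1 = exec_transform_P[of s, folded s1_def, unfolded s upper]
  let ?F = "{c, \<psi> b, a, \<psi> c}" and ?F' = "{c, \<psi> a, b, \<psi> c}"
  let ?rest = "remove1 ?F' (remove1 ?F (rfaces s))"
  have F: "?F \<in> set (rfaces s)" "?F' \<in> set (rfaces s)"
    unfolding faces using ac bc quad_ac quad_bc by (metis imageI)+
  \<comment> \<open>the two deleted faces differ since they belong to different edges\<close>
  have F_neq: "?F \<noteq> ?F'"
  proof -
    have "quad lf (a, c) \<noteq> quad lf (b, c)"
      using quad_eq_iff[OF plane_map_axioms _ ac bc] neqs disjoint by auto
    then show ?thesis unfolding quad_ac quad_bc .
  qed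
  note rest = set_remove1_remove1[OF s(4), where x = ?F and y = ?F']
  have set1: "set (rfaces s1) = quad lf' ` E'"
    unfolding s1 E'_def quad' quad_ac quad_bc list.set rest(1) faces
    by (simp only: Un_insert_right Un_empty_right)
  have D_notin: "?D \<notin> F0" "?d \<notin> F0" if "F0 \<in> set ?rest" for F0
  proof -
    have "F0 \<in> quad lf ` E" using that rest(1) faces by auto
    then obtain e where e: "e \<in> E" "F0 = quad lf e" by auto
    then have "F0 \<subseteq> Lo ` {..<n} \<union> Up ` {..<n}"
      using E_sub lf_in[of e] lf_in[of "prod.swap e"] swap_E[of e] by (auto simp: quad_def)
    then show "?D \<notin> F0" "?d \<notin> F0" by auto
  qed
  have up: "\<psi> a \<in> range Up" "\<psi> b \<in> range Up" "\<psi> c \<in> range Up" using psi_in by auto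
  have lo: "a \<in> range Lo" "b \<in> range Lo" "c \<in> range Lo" using abc_in_V by auto
  let ?G1 = "{a, \<psi> c, ?d, ?D}" and ?G2 = "{?d, \<psi> a, b, \<psi> c}"
    and ?G3 = "{c, \<psi> a, ?d, ?D}" and ?G4 = "{a, \<psi> b, c, ?D}"
  have dist1: "distinct (rfaces s1)"
  proof -
    have "?D \<notin> {?d, \<psi> a, b, \<psi> c}" using D_neq lo by auto
    moreover have "?d \<notin> {a, \<psi> b, c, ?D}" using neqs up by auto
    moreover have "a \<notin> {c, \<psi> a, ?d, ?D}" using neqs up lo by auto
    ultimately have neq: "?G1 \<noteq> ?G2" "?G1 \<noteq> ?G3" "?G1 \<noteq> ?G4" "?G2 \<noteq> ?G3" "?G2 \<noteq> ?G4" "?G3 \<noteq> ?G4"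
      by (metis insertI1 insert_commute)+
    have notin: "?G1 \<notin> set ?rest" "?G2 \<notin> set ?rest" "?G3 \<notin> set ?rest" "?G4 \<notin> set ?rest"
      using D_notin by (metis insertI1 insert_commute)+
    show ?thesis
      unfolding s1 distinct.simps list.set insert_iff empty_iff using neq notin rest(2) by blast
  qed
  have len1: "length (rfaces s1) + 2 = 2 * Suc n"
    unfolding s1 using rest(3)[OF F F_neq] s(5) by simp
  have lab1: "lab s1 Ld = ?d" "lab s1 UD = ?D" "lab s1 La = a" "lab s1 Lb = b" "lab s1 Lc = c"
      "lab s1 UA = \<psi> a" "lab s1 UB = \<psi> b" "lab s1 UC = \<psi> c"
    unfolding s1 using s upper by simp_all
  have psi': "\<psi>' ?d = ?D" "\<psi>' a = \<psi> a" "\<psi>' c = \<psi> c" using neqs by (auto simp: \<psi>'_def)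
  have ext: "insert ?d (Lo ` {..<n}) = Lo ` {..<Suc n}" "insert ?D (Up ` {..<n}) = Up ` {..<Suc n}"
    by (simp_all add: lessThan_Suc)
  have swapped: "quad (lf' \<circ> prod.swap) ` E' = quad lf' ` E'"
    by (intro image_cong) (auto simp: quad_def)
  show "represents (fold exec relabel_between (fold exec transform_P s)) (Suc n) E' a c (Lo n)"
    unfolding represents_def s1_def[symmetric] exec_relabel_between
    using between_config[unfolded ext, folded E'_def] dist1 len1 lab1 psi' set1 swapped s1(1-3) s(1-3)
    by (intro conjI exI[of _ "inv \<sigma>'"] exI[of _ "lf' \<circ> prod.swap"] exI[of _ \<psi>']) simp_all
  show "represents (fold exec relabel_last (fold exec transform_P s)) (Suc n) E' c a (Lo n)"
    unfolding represents_def s1_def[symmetric] exec_relabel_last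
    using last_config[unfolded ext, folded E'_def] dist1 len1 lab1 psi' set1 s1(1-3) s(1-3)
    by (intro conjI exI[of _ \<sigma>'] exI[of _ lf'] exI[of _ \<psi>']) simp_all
  show "deg E' v = (if v = Lo n then 3 else if v = a then Suc (deg E a) else deg E v)"
    if "v = Lo n \<or> v \<in> Lo ` {..<n}"
    using deg'(1,2) deg'(3)[of v] by (simp add: E'_def)
  show "a \<in> Lo ` {..<n}" "c \<in> Lo ` {..<n}" "a \<noteq> c" using abc_in_V neqs by auto
qed

text \<open>
  Each face of the cube has two lower-case and two upper-case vertices, with four different indices.
\<close>

lemma cube_face:
  assumes "{Lo k, Up q, Lo i, Up r} \<in>
      {{Lo 0, Lo 1, Up 2, Up 3}, {Lo 0, Lo 2, Up 1, Up 3}, {Lo 0, Lo 3, Up 1, Up 2},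
        {Lo 1, Lo 2, Up 0, Up 3}, {Lo 1, Lo 3, Up 0, Up 2}, {Lo 2, Lo 3, Up 0, Up 1}}"
  shows "{k, i} \<inter> {q, r} = {} \<and> {k, i} \<union> {q, r} = {..<4::nat}"
proof -
  have lo: "{n. Lo n \<in> {Lo k, Up q, Lo i, Up r}} = {k, i}"
    and up: "{n. Up n \<in> {Lo k, Up q, Lo i, Up r}} = {q, r}" by auto
  have eq: "{k, i} = {t, u} \<and> {q, r} = {v, w}"
    if "{Lo k, Up q, Lo i, Up r} = {Lo t, Lo u, Up v, Up w}" for t u v w
    using lo up unfolding that by auto
  have four: "{..<4::nat} = {0, 1, 2, 3}" by auto
  from assms show ?thesis
    unfolding insert_iff empty_iff simp_thms four by (elim disjE) (drule eq, elim conjE, simp add: insert_commute)+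
qed

text \<open>The face of the cube that belongs to the edge \<open>uw\<close> of the tetrahedron with \<open>Up j\<close> opposite to \<open>Lo j\<close>.\<close>

definition opposite_quad :: "nat \<times> nat \<Rightarrow> rvertex set" where
  "opposite_quad = (\<lambda>(u, w). {Lo u, Lo w} \<union> Up ` ({..<4} - {u, w}))"

lemma opposite_quad_image:
  assumes dist: "distinct [i, j, k, r]" and four: "{..<4} = {i, j, k, r}"
  shows "opposite_quad ` complete_arcs {..<4} =
    {{Lo i, Lo j, Up k, Up r}, {Lo i, Lo k, Up j, Up r}, {Lo i, Lo r, Up j, Up k},
     {Lo j, Lo k, Up i, Up r}, {Lo j, Lo r, Up i, Up k}, {Lo k, Lo r, Up i, Up j}}"
proof -
  have neq: "i \<noteq> j" "i \<noteq> k" "i \<noteq> r" "j \<noteq> k" "j \<noteq> r" "k \<noteq> r" using dist by auto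
  have comp: "{..<4} - {i, j} = {k, r}" "{..<4} - {i, k} = {j, r}" "{..<4} - {j, k} = {i, r}"
    "{..<4} - {i, r} = {j, k}" "{..<4} - {j, r} = {i, k}" "{..<4} - {k, r} = {i, j}"
    unfolding four using neq by auto
  have F: "opposite_quad (i, j) = {Lo i, Lo j, Up k, Up r}"
    "opposite_quad (i, k) = {Lo i, Lo k, Up j, Up r}"
    "opposite_quad (i, r) = {Lo i, Lo r, Up j, Up k}"
    "opposite_quad (j, k) = {Lo j, Lo k, Up i, Up r}"
    "opposite_quad (j, r) = {Lo j, Lo r, Up i, Up k}"
    "opposite_quad (k, r) = {Lo k, Lo r, Up i, Up j}"
    unfolding opposite_quad_def prod.case comp by auto
  have flip: "opposite_quad (u, w) = opposite_quad (w, u)" for u w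
    by (simp add: opposite_quad_def insert_commute)
  show ?thesis
    unfolding four complete_arcs_4[OF dist] image_insert image_empty
      flip[of j i] flip[of k i] flip[of k j] flip[of r] F insert_absorb2
    by (simp only: insert_commute)
qed

text \<open>
  All 24 admissible labellings of the cube look alike: if \<open>a\<close>, \<open>b\<close>, \<open>c\<close> have the indices \<open>i\<close>, \<open>j\<close>, \<open>k\<close> and
  \<open>C\<close> has the index \<open>r\<close>, then the two faces of the configuration force \<open>A\<close> and \<open>B\<close> to have the indices
  \<open>i\<close> and \<open>j\<close>, and \<open>r\<close> to be the fourth index, that of the unlabelled vertex \<open>x\<close>.
\<close>

lemma cube_start_represents:
  assumes "cube_start s"
  obtains a b c x where "distinct [a, b, c, x]" "Lo ` {..<4} = {a, b, c, x}"
    "represents s 4 (complete_arcs {a, b, c, x}) a b c"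
proof -
  have s: "nlow s = 4" "nup s = 4" "outp s = \<lparr>pverts = {}, parcs = {}\<rparr>"
    and faces: "rfaces s =
       [{Lo 0, Lo 1, Up 2, Up 3}, {Lo 0, Lo 2, Up 1, Up 3}, {Lo 0, Lo 3, Up 1, Up 2},
        {Lo 1, Lo 2, Up 0, Up 3}, {Lo 1, Lo 3, Up 0, Up 2}, {Lo 2, Lo 3, Up 0, Up 1}]"
    and conf: "configuration s"
    using assms by (auto simp: cube_start_def)
  define a b c A B C where abc: "a = lab s La" "b = lab s Lb" "c = lab s Lc"
    "A = lab s UA" "B = lab s UB" "C = lab s UC"
  have "distinct [a, b, c, A, B, C] \<and> {a, b, c} \<subseteq> range Lo \<and> {A, B, C} \<subseteq> range Up \<and>
      {{a, B}, {a, C}, {b, A}, {b, C}, {c, A}, {c, B}, {c, C}} \<subseteq> redges s \<and>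
      {{c, B, a, C}, {c, A, b, C}} \<subseteq> set (rfaces s)"
    using conf unfolding configuration_def Let_def abc[symmetric] .
  then have conf: "distinct [a, b, c, A, B, C]" "{a, b, c} \<subseteq> range Lo" "{A, B, C} \<subseteq> range Up"
    "{c, B, a, C} \<in> set (rfaces s)" "{c, A, b, C} \<in> set (rfaces s)"
    by (simp_all only: insert_subset simp_thms)
  obtain i j k where ijk: "a = Lo i" "b = Lo j" "c = Lo k" using conf(2) by auto
  obtain p q r where pqr: "A = Up p" "B = Up q" "C = Up r" using conf(3) by auto
  note ijk = ijk pqr
  have neq: "i \<noteq> j" "i \<noteq> k" "j \<noteq> k" "p \<noteq> q" "p \<noteq> r" "q \<noteq> r"
    using conf(1) unfolding ijk by auto
  have face1: "{k, i} \<inter> {q, r} = {} \<and> {k, i} \<union> {q, r} = {..<4::nat}"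
    by (rule cube_face) (use conf(4) in \<open>simp only: faces ijk list.set\<close>)
  have face2: "{k, j} \<inter> {p, r} = {} \<and> {k, j} \<union> {p, r} = {..<4::nat}"
    by (rule cube_face) (use conf(5) in \<open>simp only: faces ijk list.set\<close>)
  have r: "r \<notin> {i, j, k}" using face1 face2 by auto
  have "i \<in> {k, j} \<union> {p, r}" "j \<in> {k, i} \<union> {q, r}" using face1 face2 by auto
  then have pq: "p = i" "q = j" "r \<notin> {i, j, k}" using r neq by auto
  have four: "{..<4} = {i, j, k, r}" using face1 pq by auto
  obtain \<sigma> lf \<psi> where sdm: "self_dual_map {a, b, c, Lo r} {A, B, C, Up k}
        (complete_arcs {a, b, c, Lo r}) \<sigma> lf \<psi> a b c"
    and psi: "\<psi> a = A" "\<psi> b = B" "\<psi> c = C"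
    and quads: "quad lf ` complete_arcs {a, b, c, Lo r} =
      {{a, b, C, Up k}, {a, c, B, C}, {b, c, A, C}, {a, Lo r, B, Up k}, {b, Lo r, A, Up k}, {c, Lo r, A, B}}"
    using tetrahedron[of a b c "Lo r" A B C "Up k"] neq pq unfolding ijk by auto
  have V: "Lo ` {..<4} = {a, b, c, Lo r}" and U: "Up ` {..<4} = {A, B, C, Up k}"
    unfolding four ijk pq by auto
  have "set (rfaces s) = opposite_quad ` complete_arcs {..<4}"
    using opposite_quad_image[of 0 1 2 3] by (simp add: faces lessThan_nat_numeral lessThan_Suc insert_commute)
  also have "\<dots> = quad lf ` complete_arcs {a, b, c, Lo r}"
  proof -
    have "distinct [i, j, k, r]" using neq pq(3) by auto
    from opposite_quad_image[OF this four] show ?thesis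
      unfolding quads unfolding ijk pq by (simp only: insert_commute)
  qed
  finally have set: "set (rfaces s) = quad lf ` complete_arcs {a, b, c, Lo r}" .
  \<comment> \<open>these three memberships already tell the six faces apart\<close>
  have "distinct (map (\<lambda>F. (Lo 0 \<in> F, Lo 1 \<in> F, Lo 2 \<in> F)) (rfaces s))" unfolding faces by simp
  then have "distinct (rfaces s)" by (simp add: distinct_map)
  moreover have "length (rfaces s) + 2 = 2 * 4" unfolding faces by simp
  ultimately have "represents s 4 (complete_arcs {a, b, c, Lo r}) a b c"
    unfolding represents_def V U using s sdm psi set abc
    by (intro conjI exI[of _ \<sigma>] exI[of _ lf] exI[of _ \<psi>]) simp_all
  moreover have "distinct [a, b, c, Lo r]" unfolding ijk using neq pq(3) by auto
  ultimately show thesis using that V by blast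
qed

section \<open>Degrees through the loop\<close>

lemma deg_complete:
  assumes "distinct [a, b, c, x]" "v \<in> {a, b, c, x}"
  shows "deg (complete_arcs {a, b, c, x}) v = 3"
proof -
  have "{e \<in> complete_arcs {a, b, c, x}. fst e = v} = Pair v ` ({a, b, c, x} - {v})"
    using assms(2) by (auto simp: complete_arcs_def)
  then have "deg (complete_arcs {a, b, c, x}) v = card ({a, b, c, x} - {v})"
    by (simp add: deg_def card_image inj_on_def)
  then show ?thesis using assms by (simp add: card_Diff_singleton)
qed

definition degrees :: "nat \<Rightarrow> rvertex rel \<Rightarrow> nat multiset" where
  "degrees n E = image_mset (deg E) (mset_set (Lo ` {..<n}))"

text \<open>
  One occurrence of \<open>deg E a\<close> is replaced by its successor, and a 3 is added.  The equation is stated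
  without a difference of multisets, so that it can be chained by cancellation.
\<close>

lemma degrees_step:
  assumes "represents s n E a b c"
  shows "add_mset (deg E a) (degrees (Suc n) (subdivide_join E a b c (Lo n))) =
    add_mset (Suc (deg E a)) (add_mset 3 (degrees n E))"
proof -
  let ?V = "Lo ` {..<n}" and ?E = "subdivide_join E a b c (Lo n)"
  note deg = represents_transform_P(3)[OF assms]
  have a: "a \<in> ?V" by (rule represents_transform_P(4)[OF assms])
  have V: "mset_set ?V = add_mset a (mset_set (?V - {a}))"
    using a by (intro mset_set.remove) auto
  have "mset_set (Lo ` {..<Suc n}) = add_mset (Lo n) (mset_set ?V)"
    unfolding lessThan_Suc image_insert by (intro mset_set.insert) auto
  moreover have "image_mset (deg ?E) (mset_set (?V - {a})) = image_mset (deg E) (mset_set (?V - {a}))"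
    by (intro image_mset_cong) (use deg in auto)
  moreover have "deg ?E (Lo n) = 3" "deg ?E a = Suc (deg E a)"
    using deg[of "Lo n"] deg[of a] a by auto
  ultimately show ?thesis unfolding degrees_def V by simp
qed

lemma replicate_mset_plus: "replicate_mset (k + l) x = replicate_mset k x + replicate_mset l x"
  by (induction k) simp_all

text \<open>
  A round is one pass through the loop of an entry: its loop control, the transformation and a relabelling.
\<close>

definition between_round :: "elem_op list" where
  "between_round = Loop_Control # transform_P @ relabel_between"

definition last_round :: "elem_op list" where
  "last_round = Loop_Control # transform_P @ relabel_last"

lemma process_entry_rounds:
  assumes "4 \<le> t"
  shows "process_entry t =
    Loop_Control # concat (replicate (t - 4) between_round) @ last_round"
proof -
  have "[1..<Suc (t - 3)] = [1..<t - 3] @ [t - 3]" using assms by simp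
  moreover have "map (\<lambda>j. Loop_Control # transform_P @ (if j < t - 3 then relabel_between else relabel_last))
      [1..<t - 3] = replicate (t - 4) between_round"
    using assms by (intro replicate_eqI) (auto simp: between_round_def)
  ultimately show ?thesis by (simp add: process_entry_def last_round_def)
qed

lemma represents_round:
  assumes "represents s n E a b c"
  shows "represents (fold exec between_round s) (Suc n) (subdivide_join E a b c (Lo n)) a c (Lo n)"
    and "represents (fold exec last_round s) (Suc n) (subdivide_join E a b c (Lo n)) c a (Lo n)"
  using represents_transform_P(1,2)[OF assms] by (simp_all add: between_round_def last_round_def)

text \<open>
  Between two rounds of an entry \<open>a\<close> is kept and the vertex created last becomes \<open>c\<close>.  So, apart from the
  new threes, only the degree of \<open>a\<close> grows; and the current \<open>c\<close>, to be \<open>a\<close> in the next entry, has degree 3.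
\<close>

lemma represents_between_rounds:
  assumes "represents s n E a b c" "deg E c = 3"
  shows "\<exists>E' b' c'. represents (fold exec (concat (replicate k between_round)) s) (n + k) E' a b' c' \<and>
    deg E' a = deg E a + k \<and> deg E' c' = 3 \<and>
    add_mset (deg E a) (degrees (n + k) E') =
      add_mset (deg E a + k) (degrees n E + replicate_mset k 3)"
proof (induction k)
  case 0
  then show ?case using assms by (intro exI[of _ E] exI[of _ b] exI[of _ c]) simp
next
  case (Suc k)
  then obtain E1 b1 c1 where
    rep: "represents (fold exec (concat (replicate k between_round)) s) (n + k) E1 a b1 c1"
    and deg: "deg E1 a = deg E a + k"
    and ms: "add_mset (deg E a) (degrees (n + k) E1) =
      add_mset (deg E a + k) (degrees n E + replicate_mset k 3)"
    by blast
  let ?E = "subdivide_join E1 a b1 c1 (Lo (n + k))"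
  have "concat (replicate (Suc k) between_round) = concat (replicate k between_round) @ between_round"
    by (simp flip: replicate_append_same)
  then have "represents (fold exec (concat (replicate (Suc k) between_round)) s) (n + Suc k) ?E a c1 (Lo (n + k))"
    using represents_round(1)[OF rep] by simp
  moreover have "deg ?E a = deg E a + Suc k" "deg ?E (Lo (n + k)) = 3"
    using represents_transform_P(3)[OF rep] represents_transform_P(4)[OF rep] deg by auto
  moreover have "add_mset (deg E a) (degrees (n + Suc k) ?E) =
      add_mset (deg E a + Suc k) (degrees n E + replicate_mset (Suc k) 3)"
  proof -
    \<comment> \<open>a common \<open>deg E a + k\<close> on both sides, to be cancelled at the end\<close>
    have "add_mset (deg E a + k) (add_mset (deg E a) (degrees (n + Suc k) ?E)) =
        add_mset (deg E a + Suc k) (add_mset 3 (add_mset (deg E a) (degrees (n + k) E1)))"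
      using degrees_step[OF rep] deg by (simp add: add_mset_commute)
    also have "\<dots> = add_mset (deg E a + k)
        (add_mset (deg E a + Suc k) (degrees n E + replicate_mset (Suc k) 3))"
      unfolding ms by (simp add: add_mset_commute)
    finally show ?thesis by simp
  qed
  ultimately show ?case by blast
qed

lemma represents_process_entry:
  assumes "represents s n E a b c" "deg E a = 3" "deg E c = 3" "4 \<le> t"
  shows "\<exists>E' a' b' c'. represents (fold exec (process_entry t) s) (n + (t - 3)) E' a' b' c' \<and>
    deg E' a' = 3 \<and> deg E' c' = 3 \<and>
    degrees (n + (t - 3)) E' = add_mset t (degrees n E + replicate_mset (t - 4) 3)"
proof -
  obtain k where t: "t = k + 4" using assms(4) by (metis add.commute le_Suc_ex)
  obtain E1 b1 c1 where
    rep: "represents (fold exec (concat (replicate k between_round)) s) (n + k) E1 a b1 c1"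
    and deg: "deg E1 a = 3 + k" "deg E1 c1 = 3"
    and ms: "add_mset 3 (degrees (n + k) E1) = add_mset (3 + k) (degrees n E + replicate_mset k 3)"
    using represents_between_rounds[OF assms(1,3), of k] unfolding assms(2) by blast
  let ?E = "subdivide_join E1 a b1 c1 (Lo (n + k))"
  have "represents (fold exec (process_entry t) s) (n + (t - 3)) ?E c1 a (Lo (n + k))"
    using represents_round(2)[OF rep] by (simp add: process_entry_rounds t)
  moreover have "deg ?E c1 = 3" "deg ?E (Lo (n + k)) = 3"
    using represents_transform_P(3)[OF rep] represents_transform_P(5,6)[OF rep] deg by auto
  moreover have "degrees (n + (t - 3)) ?E = add_mset t (degrees n E + replicate_mset (t - 4) 3)"
    using degrees_step[OF rep] unfolding deg ms by (simp add: t add_mset_commute)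
  ultimately show ?thesis by blast
qed

lemma represents_process_tuple:
  assumes "represents s n E a b c" "deg E a = 3" "deg E c = 3" "valid_input T"
  shows "\<exists>E' a' b' c'. represents (fold exec (process_tuple T) s) (n + (\<Sum>t\<leftarrow>T. t - 3)) E' a' b' c' \<and>
    degrees (n + (\<Sum>t\<leftarrow>T. t - 3)) E' =
      degrees n E + mset T + replicate_mset (\<Sum>t\<leftarrow>T. t - 4) 3"
  using assms
proof (induction T arbitrary: s n E a b c)
  case Nil
  then show ?case by (auto simp: process_tuple_def)
next
  case (Cons t T)
  have t: "4 \<le> t" and T: "valid_input T" using Cons.prems(4) by (auto simp: valid_input_def)
  obtain E1 a1 b1 c1 where rep: "represents (fold exec (process_entry t) s) (n + (t - 3)) E1 a1 b1 c1"
    and deg: "deg E1 a1 = 3" "deg E1 c1 = 3"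
    and ms: "degrees (n + (t - 3)) E1 = add_mset t (degrees n E + replicate_mset (t - 4) 3)"
    using represents_process_entry[OF Cons.prems(1-3) t] by blast
  from Cons.IH[OF rep deg T] show ?case
    unfolding ms by (simp add: process_tuple_def replicate_mset_plus ac_simps)
qed

section \<open>Output and running time\<close>

lemma outp_output:
  "outp (fold exec (map (\<lambda>i. Out_Vertex (Lo i)) xs) s) =
     (outp s)\<lparr>pverts := pverts (outp s) \<union> Lo ` set xs\<rparr>"
  "outp (fold exec (map Out_Face Fs) s) =
     (outp s)\<lparr>parcs := parcs (outp s) \<union>
        (\<Union>F\<in>set Fs. {(u, w). u \<in> F \<inter> range Lo \<and> w \<in> F \<inter> range Lo \<and> u \<noteq> w})\<rparr>"
  by (induction xs arbitrary: s, simp_all) (induction Fs arbitrary: s, simp_all add: Un_assoc)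

text \<open>
  The lower-case vertices on the face of \<open>R\<close> belonging to an edge are the ends of this edge, so the
  output phase recovers exactly the arcs.
\<close>

lemma represents_arcs:
  assumes "represents s n E a b c"
  shows "(\<Union>F\<in>set (rfaces s). {(u, w). u \<in> F \<inter> range Lo \<and> w \<in> F \<inter> range Lo \<and> u \<noteq> w}) = E"
proof -
  obtain \<sigma> lf \<psi> where sdm: "self_dual_map (Lo ` {..<n}) (Up ` {..<n}) E \<sigma> lf \<psi> a b c"
    and faces: "set (rfaces s) = quad lf ` E"
    using assms unfolding represents_def by blast
  interpret self_dual_map "Lo ` {..<n}" "Up ` {..<n}" E \<sigma> lf \<psi> a b c by (rule sdm)
  have F: "{(u, w). u \<in> quad lf e \<inter> range Lo \<and> w \<in> quad lf e \<inter> range Lo \<and> u \<noteq> w} = {e, prod.swap e}"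
    if e: "e \<in> E" for e
  proof -
    have "lf e \<in> range Up" "lf (prod.swap e) \<in> range Up"
      using lf_in[of e] lf_in[of "prod.swap e"] swap_E[of e] e by auto
    moreover have "fst e \<in> range Lo" "snd e \<in> range Lo" using e E_sub by auto
    ultimately have "quad lf e \<inter> range Lo = {fst e, snd e}" by (auto simp: quad_def)
    moreover have "fst e \<noteq> snd e" using e E_irrefl by (cases e) auto
    ultimately show ?thesis by (cases e) auto
  qed
  have "(\<Union>F\<in>set (rfaces s). {(u, w). u \<in> F \<inter> range Lo \<and> w \<in> F \<inter> range Lo \<and> u \<noteq> w}) =
      (\<Union>e\<in>E. {e, prod.swap e})"
    unfolding faces image_image using F by simp
  also have "\<dots> = E" using swap_E by auto
  finally show ?thesis .
qed

lemma result_graph_eq: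
  assumes "represents (fold exec (process_tuple T) s) n E a b c"
  shows "result_graph s T = \<lparr>pverts = Lo ` {..<n}, parcs = E\<rparr>"
    and "running_time s T = length (process_tuple T) + n + (2 * n - 2)"
proof -
  let ?s = "fold exec (process_tuple T) s"
  have s: "nlow ?s = n" "outp ?s = \<lparr>pverts = {}, parcs = {}\<rparr>" "length (rfaces ?s) = 2 * n - 2"
    using assms unfolding represents_def by auto
  have "result_graph s T = outp (fold exec (output_graph ?s) ?s)"
    by (simp add: result_graph_def algorithm_A_def run_def)
  also have "\<dots> = \<lparr>pverts = Lo ` {..<n}, parcs = E\<rparr>"
    unfolding output_graph_def fold_append comp_def
    using represents_arcs[OF assms] by (simp add: outp_output s atLeast_upt)
  finally show "result_graph s T = \<lparr>pverts = Lo ` {..<n}, parcs = E\<rparr>" .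
  show "running_time s T = length (process_tuple T) + n + (2 * n - 2)"
    by (simp add: running_time_def algorithm_A_def run_def output_graph_def s)
qed

text \<open>
  A round takes at most 21 operations, and an entry one more for reading it, which is charged to its
  first round; so 22 operations are paid for each created vertex.
\<close>

lemma length_process_tuple:
  assumes "valid_input T"
  shows "length (process_tuple T) \<le> 22 * (\<Sum>t\<leftarrow>T. t - 3)"
  using assms
proof (induction T)
  case Nil
  then show ?case by (simp add: process_tuple_def)
next
  case (Cons t T)
  have len: "length between_round = 19" "length last_round = 21"
    by (simp_all add: between_round_def last_round_def transform_P_def relabel_between_def relabel_last_def)
  have "4 \<le> t" using Cons.prems by (simp add: valid_input_def)
  then have "length (process_entry t) \<le> 22 * (t - 3)"
    by (simp add: process_entry_rounds length_concat sum_list_replicate len)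
  then show ?case using Cons \<open>4 \<le> t\<close> by (auto simp: process_tuple_def valid_input_def)
qed

lemma out_degree_eq_deg: "out_degree (with_proj \<lparr>pverts = V, parcs = E\<rparr>) = deg E"
  by (simp add: fun_eq_iff out_degree_def out_arcs_def deg_def)

lemma degrees_complete:
  assumes "distinct [a, b, c, x]" "Lo ` {..<4} = {a, b, c, x}"
  shows "degrees 4 (complete_arcs {a, b, c, x}) = replicate_mset 4 3"
proof -
  have "degrees 4 (complete_arcs {a, b, c, x}) = image_mset (\<lambda>_. 3) (mset_set (Lo ` {..<4}))"
    unfolding degrees_def by (intro image_mset_cong) (use assms in \<open>auto intro!: deg_complete\<close>)
  moreover have "card (Lo ` {..<4::nat}) = 4" by (simp add: card_image inj_on_def)
  ultimately show ?thesis by (simp add: image_mset_const_eq)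
qed

section \<open>The order of the entries matters\<close>

definition all_adjacent :: "nat \<Rightarrow> nat \<Rightarrow> 'v pair_pre_digraph \<Rightarrow> bool" where
  "all_adjacent p q G \<longleftrightarrow> (\<forall>u\<in>pverts G. \<forall>v\<in>pverts G.
     out_degree (with_proj G) u = p \<longrightarrow> out_degree (with_proj G) v = q \<longrightarrow> (u, v) \<in> parcs G)"

lemma all_adjacent_iso:
  assumes iso: "digraph_iso (with_proj G) (with_proj H)" and H: "all_adjacent p q H"
  shows "all_adjacent p q G"
  unfolding all_adjacent_def
proof (intro ballI impI)
  fix u v assume u: "u \<in> pverts G" "out_degree (with_proj G) u = p"
    and v: "v \<in> pverts G" "out_degree (with_proj G) v = q"
  obtain f where f: "pre_digraph.digraph_isomorphism (with_proj G) f"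
    and Hf: "with_proj H = app_iso f (with_proj G)"
    using iso unfolding digraph_iso_def by blast
  interpret G: wf_digraph "with_proj G" using f by (simp add: pre_digraph.digraph_isomorphism_def)
  let ?f = "iso_verts f"
  have H_verts: "pverts H = ?f ` pverts G" using arg_cong[OF Hf, of verts] by simp
  have H_arcs: "parcs H = (\<lambda>(u, v). (?f u, ?f v)) ` parcs G"
    using G.arcs_ends_app_iso_eq[OF f] unfolding Hf[symmetric] by simp
  have deg: "out_degree (with_proj H) (?f w) = out_degree (with_proj G) w" if "w \<in> pverts G" for w
    using G.out_degree_app_iso_eq[OF f] that unfolding Hf[symmetric] by simp
  have "(?f u, ?f v) \<in> parcs H"
    using H u v H_verts deg unfolding all_adjacent_def by auto
  then obtain u' v' where uv': "(u', v') \<in> parcs G" "?f u' = ?f u" "?f v' = ?f v"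
    unfolding H_arcs by auto
  have "u' \<in> pverts G" "v' \<in> pverts G"
    using G.tail_in_verts[of "(u', v')"] G.head_in_verts[of "(u', v')"] uv'(1) by auto
  then have "u' = u" "v' = v"
    using uv'(2,3) u v G.iso_verts_eq_iff[OF f] by auto
  then show "(u, v) \<in> parcs G" using uv'(1) by simp
qed

lemma process_tuple_445: "process_tuple [4, 4, 5] =
    (Loop_Control # last_round) @ (Loop_Control # last_round) @
    (Loop_Control # between_round @ last_round)"
  by (simp add: process_tuple_def process_entry_rounds)

lemma process_tuple_454: "process_tuple [4, 5, 4] =
    (Loop_Control # last_round) @ (Loop_Control # between_round @ last_round) @
    (Loop_Control # last_round)"
  by (simp add: process_tuple_def process_entry_rounds)

text \<open>
  The three entries raise the degrees of the initial \<open>a\<close>, the initial \<open>c\<close> and the first new vertex \<open>Lo 4\<close>.  The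
  edge between \<open>a\<close> and \<open>Lo 4\<close> is the one subdivided in the second step, so these two vertices, of
  degrees 4 and 5, are not adjacent.
\<close>

lemma not_all_adjacent_445:
  assumes "cube_start s"
  shows "\<not> all_adjacent 5 4 (result_graph s [4, 4, 5])"
proof -
  obtain a b c x where dist: "distinct [a, b, c, x]" and V: "Lo ` {..<4} = {a, b, c, x}"
    and rep0: "represents s 4 (complete_arcs {a, b, c, x}) a b c"
    by (rule cube_start_represents[OF assms])
  define E1 where "E1 = subdivide_join (complete_arcs {a, b, c, x}) a b c (Lo 4)"
  define E2 where "E2 = subdivide_join E1 c a (Lo 4) (Lo 5)"
  define E3 where "E3 = subdivide_join E2 (Lo 4) c (Lo 5) (Lo 6)"
  define E4 where "E4 = subdivide_join E3 (Lo 4) (Lo 5) (Lo 6) (Lo 7)"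
  note rep1 = represents_round(2)[OF rep0, folded E1_def, simplified]
  note rep2 = represents_round(2)[OF rep1, folded E2_def, simplified]
  note rep3 = represents_round(1)[OF rep2, folded E3_def, simplified]
  note rep4 = represents_round(2)[OF rep3, folded E4_def, simplified]
  have res: "result_graph s [4, 4, 5] = \<lparr>pverts = Lo ` {..<8}, parcs = E4\<rparr>"
    by (rule result_graph_eq(1)) (use rep4 in \<open>simp add: process_tuple_445\<close>)
  have neq: "a \<noteq> b" "b \<noteq> a" "a \<noteq> c" "c \<noteq> a" "a \<noteq> x" "x \<noteq> a"
    "b \<noteq> c" "c \<noteq> b" "b \<noteq> x" "x \<noteq> b" "c \<noteq> x" "x \<noteq> c"
    using dist by auto
  have fresh: "v \<noteq> Lo m" "Lo m \<noteq> v" and old: "v \<in> Lo ` {..<m}"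
    if "v \<in> {a, b, c, x}" "4 \<le> m" for v m
    using that unfolding V[symmetric] by auto
  note deg1 = represents_transform_P(3)[OF rep0, folded E1_def]
  note deg2 = represents_transform_P(3)[OF rep1, folded E2_def]
  note deg3 = represents_transform_P(3)[OF rep2, folded E3_def]
  note deg4 = represents_transform_P(3)[OF rep3, folded E4_def]
  have "deg E4 (Lo 4) = 5"
    by (simp add: deg1 deg2 deg3 deg4 neq fresh old deg_complete[OF dist])
  moreover have "deg E4 a = 4"
    by (simp_all add: deg1 deg2 deg3 deg4 neq fresh old deg_complete[OF dist])
  moreover have "(Lo 4, a) \<notin> E4"
    by (simp add: E2_def E3_def E4_def subdivide_join_def neq fresh)
  moreover have "a \<in> Lo ` {..<8}" "Lo 4 \<in> Lo ` {..<8}" by (simp_all add: old)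
  ultimately show ?thesis
    unfolding res all_adjacent_def out_degree_eq_deg by auto
qed

text \<open>
  Here the second entry takes two steps, and the third entry belongs to the vertex \<open>Lo 5\<close> created in the
  first of them.  The initial \<open>c\<close> is the only vertex of degree 5, and it is adjacent to the two vertices
  of degree 4, the initial \<open>a\<close> and \<open>Lo 5\<close>.
\<close>

lemma all_adjacent_454:
  assumes "cube_start s"
  shows "all_adjacent 5 4 (result_graph s [4, 5, 4])"
proof -
  obtain a b c x where dist: "distinct [a, b, c, x]" and V: "Lo ` {..<4} = {a, b, c, x}"
    and rep0: "represents s 4 (complete_arcs {a, b, c, x}) a b c"
    by (rule cube_start_represents[OF assms])
  define E1 where "E1 = subdivide_join (complete_arcs {a, b, c, x}) a b c (Lo 4)"
  define E2 where "E2 = subdivide_join E1 c a (Lo 4) (Lo 5)"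
  define E3 where "E3 = subdivide_join E2 c (Lo 4) (Lo 5) (Lo 6)"
  define E4 where "E4 = subdivide_join E3 (Lo 5) c (Lo 6) (Lo 7)"
  note rep1 = represents_round(2)[OF rep0, folded E1_def, simplified]
  note rep2 = represents_round(1)[OF rep1, folded E2_def, simplified]
  note rep3 = represents_round(2)[OF rep2, folded E3_def, simplified]
  note rep4 = represents_round(2)[OF rep3, folded E4_def, simplified]
  have res: "result_graph s [4, 5, 4] = \<lparr>pverts = Lo ` {..<8}, parcs = E4\<rparr>"
    by (rule result_graph_eq(1)) (use rep4 in \<open>simp add: process_tuple_454\<close>)
  have neq: "a \<noteq> b" "b \<noteq> a" "a \<noteq> c" "c \<noteq> a" "a \<noteq> x" "x \<noteq> a"
    "b \<noteq> c" "c \<noteq> b" "b \<noteq> x" "x \<noteq> b" "c \<noteq> x" "x \<noteq> c"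
    using dist by auto
  have fresh: "v \<noteq> Lo m" "Lo m \<noteq> v" and old: "v \<in> Lo ` {..<m}"
    if "v \<in> {a, b, c, x}" "4 \<le> m" for v m
    using that unfolding V[symmetric] by auto
  note deg1 = represents_transform_P(3)[OF rep0, folded E1_def]
  note deg2 = represents_transform_P(3)[OF rep1, folded E2_def]
  note deg3 = represents_transform_P(3)[OF rep2, folded E3_def]
  note deg4 = represents_transform_P(3)[OF rep3, folded E4_def]
  have V8: "Lo ` {..<8} = {a, b, c, x, Lo 4, Lo 5, Lo 6, Lo 7}"
  proof -
    have "{..<8::nat} = {..<4} \<union> {4, 5, 6, 7}" by auto
    then show ?thesis by (auto simp: image_Un V)
  qed
  have "deg E4 a = 4" "deg E4 b = 3" "deg E4 c = 5" "deg E4 x = 3"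
    "deg E4 (Lo 4) = 3" "deg E4 (Lo 5) = 4" "deg E4 (Lo 6) = 3" "deg E4 (Lo 7) = 3"
    by (simp_all add: deg1 deg2 deg3 deg4 neq fresh old deg_complete[OF dist])
  moreover have "(c, a) \<in> E4" "(c, Lo 5) \<in> E4"
    by (simp_all add: neq fresh E1_def E2_def E3_def E4_def subdivide_join_def complete_arcs_def)
  ultimately show ?thesis
    unfolding res all_adjacent_def out_degree_eq_deg pair_pre_digraph.simps V8 by auto
qed

section \<open>The properties of the algorithm\<close>

lemma result_of_algorithm:
  assumes "cube_start s" "valid_input T"
  obtains n E a b c where "represents (fold exec (process_tuple T) s) n E a b c"
    and "n = 4 + (\<Sum>t\<leftarrow>T. t - 3)"
    and "degrees n E = mset T + replicate_mset (4 + (\<Sum>t\<leftarrow>T. t - 4)) 3"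
proof -
  obtain a b c x where dist: "distinct [a, b, c, x]" and V: "Lo ` {..<4} = {a, b, c, x}"
    and rep: "represents s 4 (complete_arcs {a, b, c, x}) a b c"
    by (rule cube_start_represents[OF assms(1)])
  have "deg (complete_arcs {a, b, c, x}) a = 3" "deg (complete_arcs {a, b, c, x}) c = 3"
    using deg_complete[OF dist] by auto
  from represents_process_tuple[OF rep this assms(2)] obtain E' a' b' c' where
    rep': "represents (fold exec (process_tuple T) s) (4 + (\<Sum>t\<leftarrow>T. t - 3)) E' a' b' c'"
    and deg': "degrees (4 + (\<Sum>t\<leftarrow>T. t - 3)) E' =
      replicate_mset 4 3 + mset T + replicate_mset (\<Sum>t\<leftarrow>T. t - 4) 3"
    unfolding degrees_complete[OF dist V] by blast
  show thesis
    using deg' by (intro that[OF rep' refl]) (simp only: replicate_mset_plus ac_simps)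
qed

theorem theorem3:
  shows "(\<forall>s T. cube_start s \<and> valid_input T \<longrightarrow>
            polyhedral (result_graph s T) \<and>
            self_dual (result_graph s T) \<and>
            degree_sequence (result_graph s T) =
              mset T + replicate_mset (4 + (\<Sum>t\<leftarrow>T. t - 4)) 3) \<and>
         (\<exists>T T'. valid_input T \<and> mset T' = mset T \<and>
            (\<forall>s s'. cube_start s \<and> cube_start s' \<longrightarrow>
               \<not> digraph_iso (with_proj (result_graph s T)) (with_proj (result_graph s' T')))) \<and>
         (\<exists>c1 c2 :: real. 0 < c1 \<and> 0 < c2 \<and>
            (\<forall>s T. cube_start s \<and> valid_input T \<longrightarrow>
               c1 * real (order (result_graph s T)) \<le> real (running_time s T) \<and>
               real (running_time s T) \<le> c2 * real (order (result_graph s T))))"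
proof (intro conjI)
  show "\<forall>s T. cube_start s \<and> valid_input T \<longrightarrow>
      polyhedral (result_graph s T) \<and> self_dual (result_graph s T) \<and>
      degree_sequence (result_graph s T) =
        mset T + replicate_mset (4 + (\<Sum>t\<leftarrow>T. t - 4)) 3"
  proof (intro allI impI)
    fix s T assume "cube_start s \<and> valid_input T"
    then obtain n E a b c where rep: "represents (fold exec (process_tuple T) s) n E a b c"
      and deg: "degrees n E = mset T + replicate_mset (4 + (\<Sum>t\<leftarrow>T. t - 4)) 3"
      using result_of_algorithm by metis
    obtain \<sigma> lf \<psi> where "self_dual_map (Lo ` {..<n}) (Up ` {..<n}) E \<sigma> lf \<psi> a b c"
      using rep unfolding represents_def by blast
    then interpret self_dual_map "Lo ` {..<n}" "Up ` {..<n}" E \<sigma> lf \<psi> a b c .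
    show "polyhedral (result_graph s T) \<and> self_dual (result_graph s T) \<and>
        degree_sequence (result_graph s T) =
          mset T + replicate_mset (4 + (\<Sum>t\<leftarrow>T. t - 4)) 3"
      unfolding result_graph_eq(1)[OF rep]
      using polyhedral self_dual deg by (simp add: degree_sequence_def degrees_def out_degree_eq_deg)
  qed
next
  have "\<not> digraph_iso (with_proj (result_graph s [4, 4, 5])) (with_proj (result_graph s' [4, 5, 4]))"
    if "cube_start s" "cube_start s'" for s s'
    using all_adjacent_iso not_all_adjacent_445[OF that(1)] all_adjacent_454[OF that(2)] by blast
  then show "\<exists>T T'. valid_input T \<and> mset T' = mset T \<and>
      (\<forall>s s'. cube_start s \<and> cube_start s' \<longrightarrow>
         \<not> digraph_iso (with_proj (result_graph s T)) (with_proj (result_graph s' T')))"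
    by (intro exI[of _ "[4, 4, 5]"] exI[of _ "[4, 5, 4]"]) (simp add: valid_input_def)
next
  have "1 * real (order (result_graph s T)) \<le> real (running_time s T) \<and>
      real (running_time s T) \<le> 25 * real (order (result_graph s T))"
    if input: "cube_start s" "valid_input T" for s T
  proof -
    obtain n E a b c where rep: "represents (fold exec (process_tuple T) s) n E a b c"
      and n: "n = 4 + (\<Sum>t\<leftarrow>T. t - 3)"
      using result_of_algorithm[OF input] by metis
    have "order (result_graph s T) = n"
      unfolding result_graph_eq(1)[OF rep] by (simp add: order_def card_image inj_on_def)
    \<comment> \<open>at most \<open>22 (n - 4)\<close> operations for the entries and \<open>n + (2 n - 2)\<close> for the output\<close>
    then show ?thesis
      using length_process_tuple[OF input(2)] n unfolding result_graph_eq(2)[OF rep] by linarith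
  qed
  then show "\<exists>c1 c2 :: real. 0 < c1 \<and> 0 < c2 \<and>
      (\<forall>s T. cube_start s \<and> valid_input T \<longrightarrow>
         c1 * real (order (result_graph s T)) \<le> real (running_time s T) \<and>
         real (running_time s T) \<le> c2 * real (order (result_graph s T)))"
    by (intro exI[of _ 1] exI[of _ 25]) simp
qed

end
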